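(* Let $B\subset\mathbb R^n$ be the unit ball and let $D\subset\mathbb R^n$ be a bounded domain with infinite geodesic diameter, $n\ge2$. Then for every $\varepsilon>0$ there does not exist a quasiconformal mapping $\varphi$ of $B$ onto $D$ with $\varphi\in L^1_{n+\varepsilon}(B)$.
   Context: A homeomorphism $\varphi:D_1\to D_2$ between domains of $\mathbb R^n$ is quasiconformal if $\varphi\in W^1_{1,\mathrm{loc}}(D_1)$ and its local $n$-distortion $K_n(x)=\inf\{k:\ |D\varphi(x)|\le k|J(x,\varphi)|^{1/n}\}$ is uniformly bounded almost everywhere in $D_1$; here $D\varphi(x)$ is the matrix of weak first derivatives, $|D\varphi(x)|$ its operator norm and $J(x,\varphi)=\det D\varphi(x)$. A mapping $\varphi:B\to\mathbb R^n$ belongs to $L^1_p(B)$ if its coordinate functions are locally summable and weakly differentiable with weak gradients in $L_p(B)$. The geodesic diameter of a domain $D$ is the supremum over $x,y\in D$ of the intrinsic geodesic distance between $x$ and $y$ in $D$ (the infimum of lengths of curves in $D$ joining $x$ and $y$). *)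

theory Defs
  imports "HOL-Analysis.Analysis"
begin

definition is_domain :: "'a::topological_space set \<Rightarrow> bool" where
  "is_domain D \<longleftrightarrow> open D \<and> connected D \<and> D \<noteq> {}"


section \<open>Weak derivatives and Sobolev spaces\<close>

definition partial_deriv :: "'n \<Rightarrow> (real^'n \<Rightarrow> real) \<Rightarrow> real^'n \<Rightarrow> real" where
  "partial_deriv j f x = frechet_derivative f (at x) (axis j 1)"

primrec C_k :: "nat \<Rightarrow> (real^'n \<Rightarrow> real) \<Rightarrow> bool" where
  "C_k 0 f \<longleftrightarrow> continuous_on UNIV f"
| "C_k (Suc k) f \<longleftrightarrow> (\<forall>x. f differentiable (at x)) \<and> (\<forall>j. C_k k (partial_deriv j f))"

text \<open>Elements of \<open>C\<^sub>c\<^sup>\<infinity>(U)\<close>, extended by zero to the whole space.\<close>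

definition test_function :: "(real^'n) set \<Rightarrow> (real^'n \<Rightarrow> real) \<Rightarrow> bool" where
  "test_function U \<eta> \<longleftrightarrow>
     (\<forall>k. C_k k \<eta>) \<and> compact (closure {x. \<eta> x \<noteq> 0}) \<and> closure {x. \<eta> x \<noteq> 0} \<subseteq> U"

definition locally_summable ::
    "'a::euclidean_space set \<Rightarrow> ('a \<Rightarrow> 'b::euclidean_space) \<Rightarrow> bool" where
  "locally_summable U f \<longleftrightarrow> (\<forall>K. compact K \<and> K \<subseteq> U \<longrightarrow> set_integrable lebesgue K f)"

definition has_weak_gradient ::
    "(real^'n) set \<Rightarrow> (real^'n \<Rightarrow> real) \<Rightarrow> (real^'n \<Rightarrow> real^'n) \<Rightarrow> bool" where
  "has_weak_gradient U u g \<longleftrightarrow>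
     locally_summable U u \<and> locally_summable U g \<and>
     (\<forall>\<eta> j. test_function U \<eta> \<longrightarrow>
        (LINT x:U|lebesgue. u x * partial_deriv j \<eta> x) = - (LINT x:U|lebesgue. g x $ j * \<eta> x))"

text \<open>Row \<open>i\<close> of the matrix of weak derivatives is the weak gradient of the \<open>i\<close>-th coordinate
  function. The matrix is determined almost everywhere in \<open>U\<close>, and \<open>\<phi>\<close> lies in
  \<open>W\<^sup>1\<^sub>1\<close> locally on \<open>U\<close> iff it has one.\<close>

definition has_weak_derivative ::
    "(real^'n) set \<Rightarrow> (real^'n \<Rightarrow> real^'n) \<Rightarrow> (real^'n \<Rightarrow> real^'n^'n) \<Rightarrow> bool" where
  "has_weak_derivative U \<phi> A \<longleftrightarrow>
     (\<forall>i. has_weak_gradient U (\<lambda>x. \<phi> x $ i) (\<lambda>x. A x $ i))"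

definition L_space ::
    "real \<Rightarrow> 'a::euclidean_space set \<Rightarrow> ('a \<Rightarrow> 'b::euclidean_space) set" where
  "L_space p U = {f. set_borel_measurable lebesgue U f \<and>
                     set_integrable lebesgue U (\<lambda>x. norm (f x) powr p)}"

definition L1_space :: "real \<Rightarrow> (real^'n) set \<Rightarrow> (real^'n \<Rightarrow> real^'n) set" where
  "L1_space p U = {\<phi>. \<forall>i. \<exists>g. has_weak_gradient U (\<lambda>x. \<phi> x $ i) g \<and> g \<in> L_space p U}"


section \<open>Quasiconformal mappings\<close>

text \<open>The local distortion at a point, as a function of the matrix of weak derivatives there.
  It is infinite if the matrix is nonzero but singular (infimum of the empty set).
  Restricting to \<open>k \<ge> 0\<close> makes it \<open>0\<close>, rather than \<open>-\<infinity>\<close>, for the zero matrix.\<close>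

definition n_distortion :: "real^'n^'n \<Rightarrow> ereal" where
  "n_distortion A =
     Inf {ereal k | k. 0 \<le> k \<and> onorm (\<lambda>v. A *v v) \<le> k * root CARD('n) \<bar>det A\<bar>}"

definition quasiconformal ::
    "(real^'n) set \<Rightarrow> (real^'n) set \<Rightarrow> (real^'n \<Rightarrow> real^'n) \<Rightarrow> bool" where
  "quasiconformal D\<^sub>1 D\<^sub>2 \<phi> \<longleftrightarrow>
     is_domain D\<^sub>1 \<and> is_domain D\<^sub>2 \<and> (\<exists>\<psi>. homeomorphism D\<^sub>1 D\<^sub>2 \<phi> \<psi>) \<and>
     (\<exists>A. has_weak_derivative D\<^sub>1 \<phi> A \<and>
          (\<exists>K::real. AE x\<in>D\<^sub>1 in lebesgue. n_distortion (A x) \<le> ereal K))"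


section \<open>Geodesic diameter\<close>

definition curve_length :: "(real \<Rightarrow> 'a::metric_space) \<Rightarrow> ennreal" where
  "curve_length \<gamma> =
     Sup {ennreal (\<Sum>i<N. dist (\<gamma> (t i)) (\<gamma> (t (Suc i)))) | (N::nat) (t::nat \<Rightarrow> real).
            mono_on {..N} t \<and> t ` {..N} \<subseteq> {0..1}}"

definition geodesic_dist :: "'a::metric_space set \<Rightarrow> 'a \<Rightarrow> 'a \<Rightarrow> ennreal" where
  "geodesic_dist D x y =
     Inf {curve_length \<gamma> | \<gamma>.
            path \<gamma> \<and> path_image \<gamma> \<subseteq> D \<and> pathstart \<gamma> = x \<and> pathfinish \<gamma> = y}"

definition geodesic_diameter :: "'a::metric_space set \<Rightarrow> ennreal" where
  "geodesic_diameter D = (SUP x\<in>D. SUP y\<in>D. geodesic_dist D x y)"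

end

theory Submission
  imports Defs
begin

text \<open>A bounded continuous map \<open>\<phi>\<close> of the ball with weak gradient in \<open>L\<^sub>p\<close>, \<open>p > n\<close>, has an image
  of finite geodesic diameter. For fixed \<open>x\<close>, average over \<open>z\<close> in the ball the length of the image of the segment
  \<open>[x, z]\<close>. As in Morrey's inequality this average is bounded, uniformly in \<open>x\<close>, by a constant
  depending on the \<open>L\<^sub>p\<close> norm of the gradient; so any two points \<open>x\<close>, \<open>y\<close> share a point \<open>z\<close> for which
  the images of \<open>[x, z]\<close> and \<open>[z, y]\<close> are both short. The estimate is proved for mollifications of
  \<open>\<phi>\<close> and passes to \<open>\<phi>\<close> by Fatou's lemma and lower semicontinuity of length.\<close>


section \<open>Mollifiers\<close>

text \<open>An L_p gradient says nothing about one given segment, which is a null set when n \<ge>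
  2. Letting z range over the ball turns length into volume: for fixed \<tau> the map taking z to x
  + \<tau> (z - x) has Jacobian \<tau>^n, so by Hoelder the mean of the gradient over its image
  costs at most a factor \<tau>^(-n/p), which is integrable at 0 exactly when p > n. Points x close
  to the sphere do not spoil uniformity, because the gradient is extended by zero and its p-th power
  is integrated over the whole space. Mollification commutes with differentiation only where the
  support of the kernel stays inside the ball. For a given segment this is so for all large k, from
  an index that depends on the segment; the liminf over k absorbs this dependence. The average over
  z is taken of this liminf rather than of the length itself, since the liminf is visibly measurable
  in z.\<close>

fun flat_poly :: "nat \<Rightarrow> real poly" where
  "flat_poly 0 = 1"
| "flat_poly (Suc m) = [:0, 0, 1:] * (flat_poly m - pderiv (flat_poly m))"

text \<open>\<open>flat 0\<close> is the classical exp(-1/t), extended by zero to t \<le> 0, and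
  \<open>flat m\<close> is its m-th derivative. With s = 1/t, differentiating P(s) exp(-s) in t
  gives s^2 (P - P')(s) exp(-s), which is the recursion of \<open>flat_poly\<close>.\<close>

definition flat :: "nat \<Rightarrow> real \<Rightarrow> real" where
  "flat m t = (if t > 0 then poly (flat_poly m) (inverse t) * exp (- inverse t) else 0)"

lemma poly_times_exp_neg_tendsto_0:
  fixes Q :: "real poly"
  shows "((\<lambda>s. poly Q s * exp (- s)) \<longlongrightarrow> 0) at_top"
proof -
  have "((\<lambda>s::real. \<Sum>i\<le>degree Q. coeff Q i * (s ^ i / exp s)) \<longlongrightarrow> (\<Sum>i\<le>degree Q. coeff Q i * 0)) at_top"
    by (intro tendsto_sum tendsto_mult tendsto_const tendsto_power_div_exp_0)
  then show ?thesis
    by (simp add: poly_altdef sum_distrib_right exp_minus divide_inverse mult.assoc)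
qed

lemma flat_has_derivative: "(flat m has_real_derivative flat (Suc m) t) (at t)"
proof -
  consider "t > 0" | "t < 0" | "t = 0" by linarith
  then show ?thesis
  proof cases
    case 1
    have "((\<lambda>t. poly (flat_poly m) (inverse t) * exp (- inverse t)) has_real_derivative flat (Suc m) t) (at t)"
      using 1 by (auto simp: flat_def algebra_simps power2_eq_square intro!: derivative_eq_intros)
    then show ?thesis
      by (rule has_field_derivative_transform_within_open[of _ _ _ "{0<..}"]) (use 1 in \<open>auto simp: flat_def\<close>)
  next
    case 2
    have "((\<lambda>t. 0) has_real_derivative flat (Suc m) t) (at t)"
      using 2 by (auto simp: flat_def)
    then show ?thesis
      by (rule has_field_derivative_transform_within_open[of _ _ _ "{..<0}"]) (use 2 in \<open>auto simp: flat_def\<close>)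
  next
    case 3
    \<comment> \<open>At 0 the difference quotient is \<open>flat m s / s\<close>. Dividing by s
      multiplies the polynomial in 1/s by its variable, hence \<open>pCons 0\<close>, and the
      exponential still wins.\<close>
    have "((\<lambda>s. poly (pCons 0 (flat_poly m)) (inverse s) * exp (- inverse s)) \<longlongrightarrow> 0) (at_right (0::real))"
      using filterlim_compose[OF poly_times_exp_neg_tendsto_0 filterlim_inverse_at_top_right] .
    then have right: "((\<lambda>s. flat m s / s) \<longlongrightarrow> 0) (at_right 0)"
      by (rule Lim_transform_eventually) 
         (auto simp: flat_def eventually_at_right_less divide_inverse intro!: eventually_at_rightI[of 0 1])
    have "((\<lambda>s. flat m s / s) \<longlongrightarrow> 0) (at_left 0)"
      by (rule tendsto_eventually) (auto simp: flat_def intro!: eventually_at_leftI[of "-1" 0])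
    with right have "((\<lambda>s. flat m s / s) \<longlongrightarrow> 0) (at 0)"
      by (simp add: filterlim_split_at)
    then show ?thesis
      using 3 by (simp add: has_field_derivative_iff flat_def)
  qed
qed

section \<open>Closure properties of \<open>C_k\<close>\<close>

lemma partial_derivI:
  "(f has_derivative f') (at x) \<Longrightarrow> partial_deriv j f x = f' (axis j 1)"
  unfolding partial_deriv_def by (metis frechet_derivative_at)

lemma C_k_Suc_imp: "C_k (Suc k) f \<Longrightarrow> C_k k f"
proof (induction k arbitrary: f)
  case 0
  then show ?case
    by (auto simp: continuous_on_eq_continuous_at differentiable_imp_continuous_within)
qed auto

lemma C_k_const: "C_k k (\<lambda>_::real^'n. c)"
proof (induction k arbitrary: c)
  case (Suc k)
  have "partial_deriv j (\<lambda>_::real^'n. c) = (\<lambda>_. 0)" for j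
    by (auto simp: partial_derivI[OF has_derivative_const])
  with Suc show ?case by simp
qed simp

lemma C_k_add: "C_k k f \<Longrightarrow> C_k k g \<Longrightarrow> C_k k (\<lambda>x. f x + g x)"
proof (induction k arbitrary: f g)
  case 0
  then show ?case by (simp add: continuous_on_add)
next
  case (Suc k)
  have "partial_deriv j (\<lambda>x. f x + g x) = (\<lambda>x. partial_deriv j f x + partial_deriv j g x)" for j
  proof
    fix x
    have "(f has_derivative frechet_derivative f (at x)) (at x)"
         "(g has_derivative frechet_derivative g (at x)) (at x)"
      using Suc.prems unfolding C_k.simps frechet_derivative_works by blast+
    from partial_derivI[OF has_derivative_add[OF this]]
    show "partial_deriv j (\<lambda>x. f x + g x) x = partial_deriv j f x + partial_deriv j g x"
      by (simp add: partial_deriv_def)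
  qed
  with Suc show ?case by simp
qed

lemma C_k_mult: "C_k k f \<Longrightarrow> C_k k g \<Longrightarrow> C_k k (\<lambda>x. f x * g x)"
proof (induction k arbitrary: f g)
  case 0
  then show ?case by (simp add: continuous_on_mult)
next
  case (Suc k)
  have "partial_deriv j (\<lambda>x. f x * g x) = (\<lambda>x. f x * partial_deriv j g x + partial_deriv j f x * g x)" for j
  proof
    fix x
    have "(f has_derivative frechet_derivative f (at x)) (at x)"
         "(g has_derivative frechet_derivative g (at x)) (at x)"
      using Suc.prems unfolding C_k.simps frechet_derivative_works by blast+
    from partial_derivI[OF has_derivative_mult[OF this]]
    show "partial_deriv j (\<lambda>x. f x * g x) x = f x * partial_deriv j g x + partial_deriv j f x * g x"
      by (simp add: partial_deriv_def)
  qed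
  \<comment> \<open>The product rule leaves undifferentiated factors, so the induction hypothesis is
    applied to f and g as well as to their partial derivatives.\<close>
  moreover have "C_k k f" "C_k k g" using Suc.prems C_k_Suc_imp by auto
  ultimately show ?case using Suc by (simp add: C_k_add)
qed

lemma C_k_prod: "(\<And>i. i \<in> I \<Longrightarrow> C_k k (f i)) \<Longrightarrow> C_k k (\<lambda>x. \<Prod>i\<in>I. f i x)"
  by (induction I rule: infinite_finite_induct) (auto intro: C_k_const C_k_mult)

lemma partial_deriv_affine:
  fixes f :: "real^'n \<Rightarrow> real"
  assumes "f differentiable (at (c + s *\<^sub>R x))"
  shows "(\<lambda>x. f (c + s *\<^sub>R x)) differentiable (at x)"
    and "partial_deriv j (\<lambda>x. f (c + s *\<^sub>R x)) x = s * partial_deriv j f (c + s *\<^sub>R x)"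
proof -
  let ?f' = "frechet_derivative f (at (c + s *\<^sub>R x))"
  have f': "(f has_derivative ?f') (at (c + s *\<^sub>R x))"
    using assms frechet_derivative_works by blast
  have "((\<lambda>x. c + s *\<^sub>R x) has_derivative (\<lambda>h. s *\<^sub>R h)) (at x)"
    by (auto intro!: derivative_eq_intros)
  from has_derivative_compose[OF this f']
  have *: "((\<lambda>x. f (c + s *\<^sub>R x)) has_derivative (\<lambda>h. ?f' (s *\<^sub>R h))) (at x)" .
  then show "(\<lambda>x. f (c + s *\<^sub>R x)) differentiable (at x)"
    unfolding differentiable_def by blast
  show "partial_deriv j (\<lambda>x. f (c + s *\<^sub>R x)) x = s * partial_deriv j f (c + s *\<^sub>R x)"
    using partial_derivI[OF *] linear_scale[OF has_derivative_linear[OF f']]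
    by (simp add: partial_deriv_def)
qed

text \<open>Used with s = -1, for the reflected kernel y \<mapsto> r (q - y) of a
  convolution.\<close>

lemma C_k_affine:
  fixes f :: "real^'n \<Rightarrow> real"
  shows "C_k k f \<Longrightarrow> C_k k (\<lambda>x. f (c + s *\<^sub>R x))"
proof (induction k arbitrary: f)
  case 0
  have "continuous_on UNIV (\<lambda>x. c + s *\<^sub>R x)" by (intro continuous_intros)
  with 0 show ?case by (auto intro: continuous_on_compose2)
next
  case (Suc k)
  have "partial_deriv j (\<lambda>x. f (c + s *\<^sub>R x)) = (\<lambda>x. s * partial_deriv j f (c + s *\<^sub>R x))" for j
    using Suc.prems partial_deriv_affine(2) by fastforce
  moreover have "C_k k (\<lambda>x. s * partial_deriv j f (c + s *\<^sub>R x))" for j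
    using Suc by (intro C_k_mult C_k_const) simp
  ultimately show ?case using Suc.prems by (simp add: partial_deriv_affine(1))
qed

text \<open>A partial derivative is a constant multiple of the same expression with
  \<open>Suc m\<close>, so the induction on k has to cover all m at once.\<close>

lemma C_k_flat: "C_k k (\<lambda>x::real^'n. flat m (c + s * x $ i))"
proof (induction k arbitrary: m)
  have D: "((\<lambda>x::real^'n. flat m (c + s * x $ i)) has_derivative
          (\<lambda>h. flat (Suc m) (c + s * x $ i) * (s * h $ i))) (at x)" for x m
  proof -
    have "((\<lambda>x::real^'n. c + s * x $ i) has_derivative (\<lambda>h. s * h $ i)) (at x)"
      by (auto intro!: derivative_eq_intros bounded_linear_imp_has_derivative bounded_linear_vec_nth)
    from has_derivative_compose[OF this flat_has_derivative[unfolded has_field_derivative_def]]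
    show ?thesis by simp
  qed
  {
    case 0
    show ?case
      using has_derivative_continuous[OF D[of m]] by (simp add: continuous_on_eq_continuous_at)
  next
    case (Suc k)
    have "partial_deriv j (\<lambda>x::real^'n. flat m (c + s * x $ i)) =
      (\<lambda>x. (s * axis j 1 $ i) * flat (Suc m) (c + s * x $ i))" for j
      using partial_derivI[OF D[of m]] by (auto simp: mult.commute)
    then show ?case
      using Suc D[of m] by (auto simp: differentiable_def intro!: C_k_mult C_k_const)
  }
qed

lemma flat_0_nonneg: "flat 0 t \<ge> 0" and flat_0_eq_0_iff: "flat 0 t = 0 \<longleftrightarrow> t \<le> 0"
  by (auto simp: flat_def)

lemma C_k_continuous: "C_k k f \<Longrightarrow> continuous_on UNIV f"
  by (induction k) (use C_k_Suc_imp in auto)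

text \<open>A product of one-dimensional bumps is smooth by the closure properties alone. The i-th
  factor is positive exactly when |x_i| < \<delta>/n, which dictates the scale n/\<delta>; summing
  over the n coordinates bounds the l1 norm, hence the Euclidean norm, by \<delta>.\<close>

lemma mollifier_exists:
  assumes "\<delta> > 0"
  obtains r :: "real^'n \<Rightarrow> real"
  where "\<And>k. C_k k r" "\<And>x. r x \<ge> 0" "\<And>x. r x \<noteq> 0 \<Longrightarrow> norm x \<le> \<delta>"
    "integrable lborel r" "(LINT x|lborel. r x) = 1"
proof -
  let ?N = "CARD('n) / \<delta>"
  define \<rho> :: "real^'n \<Rightarrow> real"
    where "\<rho> x = (\<Prod>i\<in>UNIV. flat 0 (1 + ?N * x $ i) * flat 0 (1 + (- ?N) * x $ i))" for x
  have C: "C_k k \<rho>" for k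
    unfolding \<rho>_def by (intro C_k_prod C_k_mult C_k_flat)
  have nonneg: "\<rho> x \<ge> 0" for x
    unfolding \<rho>_def by (intro prod_nonneg ballI mult_nonneg_nonneg flat_0_nonneg)
  have supp: "norm x \<le> \<delta>" if "\<rho> x \<noteq> 0" for x
  proof -
    have "\<bar>x $ i\<bar> \<le> \<delta> / CARD('n)" for i
    proof -
      have "1 + ?N * x $ i > 0 \<and> 1 + (- ?N) * x $ i > 0"
        using that by (force simp: \<rho>_def prod_zero_iff flat_0_eq_0_iff not_le)
      then show ?thesis using assms by (auto simp: field_simps abs_le_iff)
    qed
    then have "(\<Sum>i\<in>UNIV. \<bar>x $ i\<bar>) \<le> (\<Sum>i\<in>(UNIV::'n set). \<delta> / CARD('n))"
      by (intro sum_mono)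
    then show ?thesis using norm_le_l1_cart[of x] by simp
  qed
  have cont: "continuous_on UNIV \<rho>" using C C_k_continuous by blast
  have int: "integrable lborel \<rho>"
  proof -
    have "integrable lborel (\<lambda>x. indicator (cball 0 \<delta>) x *\<^sub>R \<rho> x)"
      using cont continuous_on_subset by (intro borel_integrable_compact) auto
    also have "(\<lambda>x. indicator (cball 0 \<delta>) x *\<^sub>R \<rho> x) = \<rho>"
      using supp by (force simp: indicator_def)
    finally show ?thesis .
  qed
  define c where "c = (LINT x|lborel. \<rho> x)"
  \<comment> \<open>Otherwise the open set where \<rho> is nonzero would be null, hence empty,
    although it contains the origin.\<close>
  have "c \<noteq> 0"
  proof
    assume "c = 0"
    then have "AE x in lborel. \<rho> x = 0"
      using integral_nonneg_eq_0_iff_AE[OF int] nonneg by (auto simp: c_def)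
    then have "AE x in lborel. x \<notin> {x. \<rho> x \<noteq> 0}" by simp
    moreover have "open {x. \<rho> x \<noteq> 0}"
      using cont by (intro open_Collect_neq) auto
    ultimately have "emeasure lborel {x. \<rho> x \<noteq> 0} = 0"
      by (subst (asm) AE_iff_measurable[of "{x. \<rho> x \<noteq> 0}"]) auto
    then have "negligible {x. \<rho> x \<noteq> 0}"
      using \<open>open {x. \<rho> x \<noteq> 0}\<close> by (simp add: negligible_iff_emeasure0)
    then have "{x. \<rho> x \<noteq> 0} = {}"
      using \<open>open {x. \<rho> x \<noteq> 0}\<close> open_not_negligible by blast
    moreover have "\<rho> 0 \<noteq> 0" by (simp add: \<rho>_def flat_0_eq_0_iff)
    ultimately show False by blast
  qed
  moreover have "c \<ge> 0" unfolding c_def using nonneg by simp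
  ultimately have c: "c > 0" by simp
  show ?thesis
  proof (rule that[of "\<lambda>x. inverse c * \<rho> x"])
    show "C_k k (\<lambda>x. inverse c * \<rho> x)" for k by (intro C_k_mult C_k_const C)
    show "(LINT x|lborel. inverse c * \<rho> x) = 1" using c by (simp add: c_def[symmetric])
  qed (use c nonneg supp int in auto)
qed


section \<open>Increments of mollified maps\<close>

lemma borel_measurable_vec_nth:
  fixes f :: "'a \<Rightarrow> real^'n"
  assumes "f \<in> borel_measurable M"
  shows "(\<lambda>x. f x $ j) \<in> borel_measurable M"
  using assms by (rule measurable_compose) (intro borel_measurable_continuous_onI continuous_intros)

text \<open>The weak gradient is only Lebesgue measurable and matters only on B. Its zero extension
  agrees almost everywhere with a Borel function, and from here on everything lives on the whole
  space with \<open>lborel\<close>, where Fubini and affine substitutions apply directly.\<close>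

lemma weak_gradient_borel_representative:
  fixes u :: "real^'n \<Rightarrow> real" and g :: "real^'n \<Rightarrow> real^'n"
  assumes "open B" "continuous_on B u" "has_weak_gradient B u g" "g \<in> L_space p B" "p \<ge> 0"
  obtains h where "\<And>j. h j \<in> borel_measurable borel"
    "\<And>j. (\<integral>\<^sup>+x. ennreal (\<bar>h j x\<bar> powr p) \<partial>lborel) < \<infinity>"
    "\<And>\<eta> j. test_function B \<eta> \<Longrightarrow>
       (LINT x|lborel. indicator B x * u x * partial_deriv j \<eta> x) = - (LINT x|lborel. h j x * \<eta> x)"
proof -
  have meas: "(\<lambda>x. indicator B x *\<^sub>R g x) \<in> borel_measurable lebesgue"
    using assms(4) by (simp add: L_space_def set_borel_measurable_def)
  have "\<forall>j. \<exists>h\<in>borel_measurable lborel. AE x in lborel. (indicator B x *\<^sub>R g x) $ j = h x"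
  proof
    fix j
    have "(\<lambda>x. (indicator B x *\<^sub>R g x) $ j) \<in> borel_measurable lebesgue"
      by (rule borel_measurable_vec_nth[OF meas])
    then show "\<exists>h\<in>borel_measurable lborel. AE x in lborel. (indicator B x *\<^sub>R g x) $ j = h x"
      by (rule completion_ex_borel_measurable_real)
  qed
  then obtain h where h: "\<And>j. h j \<in> borel_measurable lborel"
      "\<And>j. AE x in lborel. (indicator B x *\<^sub>R g x) $ j = h j x"
    by metis
  have hc: "AE x in lebesgue. indicator B x * g x $ j = h j x" for j
    using h(2)[of j] by (intro AE_completion) simp
  have int: "integrable lebesgue (\<lambda>x. indicator B x * norm (g x) powr p)"
    using assms(4) by (simp add: L_space_def set_integrable_def)
  have C0: "continuous_on UNIV \<eta>" "continuous_on UNIV (partial_deriv j \<eta>)" if "test_function B \<eta>" for \<eta> j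
  proof -
    have "C_k 1 \<eta>" "C_k 2 \<eta>" using that by (auto simp: test_function_def)
    then have "C_k 1 \<eta>" "C_k 1 (partial_deriv j \<eta>)" by (simp_all add: numeral_2_eq_2)
    then show "continuous_on UNIV \<eta>" "continuous_on UNIV (partial_deriv j \<eta>)"
      using C_k_continuous by blast+
  qed
  show ?thesis
  proof (rule that)
    show "h j \<in> borel_measurable borel" for j using h(1) by simp
    show "(\<integral>\<^sup>+x. ennreal (\<bar>h j x\<bar> powr p) \<partial>lborel) < \<infinity>" for j
    proof -
      have "(\<integral>\<^sup>+x. ennreal (\<bar>h j x\<bar> powr p) \<partial>lborel) = (\<integral>\<^sup>+x. ennreal (\<bar>h j x\<bar> powr p) \<partial>lebesgue)"
        using h(1) by (simp add: nn_integral_completion)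
      also have "\<dots> = (\<integral>\<^sup>+x. ennreal (\<bar>indicator B x * g x $ j\<bar> powr p) \<partial>lebesgue)"
        by (intro nn_integral_cong_AE) (use hc[of j] in \<open>auto\<close>)
      also have "\<dots> \<le> (\<integral>\<^sup>+x. ennreal (norm (indicator B x * norm (g x) powr p)) \<partial>lebesgue)"
      proof (intro nn_integral_mono ennreal_leI)
        fix x
        show "\<bar>indicator B x * g x $ j\<bar> powr p \<le> norm (indicator B x * norm (g x) powr p)"
          using \<open>p \<ge> 0\<close> by (cases "x \<in> B") (auto intro!: powr_mono2 component_le_norm_cart)
      qed
      also have "\<dots> < \<infinity>" using int by (simp add: integrable_iff_bounded)
      finally show ?thesis .
    qed
    fix \<eta> j assume \<eta>: "test_function B \<eta>"
    have [measurable]: "\<eta> \<in> borel_measurable borel" "partial_deriv j \<eta> \<in> borel_measurable borel"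
      using C0[OF \<eta>] borel_measurable_continuous_onI by auto
    have [measurable]: "(\<lambda>x. indicator B x * u x) \<in> borel_measurable borel"
      using borel_measurable_continuous_on_indicator[OF _ assms(2)] assms(1) by simp
    have [measurable]: "h j \<in> borel_measurable borel" using h(1) by simp
    have "(LINT x|lborel. indicator B x * u x * partial_deriv j \<eta> x) =
        (LINT x|lebesgue. indicator B x * u x * partial_deriv j \<eta> x)"
      by (intro integral_completion[symmetric]) simp
    also have "\<dots> = (LINT x:B|lebesgue. u x * partial_deriv j \<eta> x)"
      by (simp add: set_lebesgue_integral_def mult.assoc)
    also have "\<dots> = - (LINT x:B|lebesgue. g x $ j * \<eta> x)"
      using assms(3) \<eta> by (simp add: has_weak_gradient_def)
    also have "(LINT x:B|lebesgue. g x $ j * \<eta> x) = (LINT x|lebesgue. h j x * \<eta> x)"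
      unfolding set_lebesgue_integral_def
    proof (rule integral_cong_AE)
      have "(\<lambda>x. (indicator B x *\<^sub>R g x) $ j) \<in> borel_measurable lebesgue"
        by (rule borel_measurable_vec_nth[OF meas])
      moreover have "\<eta> \<in> borel_measurable lebesgue"
        by (intro measurable_completion) simp
      ultimately have "(\<lambda>x. (indicator B x *\<^sub>R g x) $ j * \<eta> x) \<in> borel_measurable lebesgue"
        by (rule borel_measurable_times)
      then show "(\<lambda>x. indicator B x *\<^sub>R (g x $ j * \<eta> x)) \<in> borel_measurable lebesgue"
        by (simp add: mult.assoc)
      show "(\<lambda>x. h j x * \<eta> x) \<in> borel_measurable lebesgue"
        by (intro measurable_completion) simp
      show "AE x in lebesgue. indicator B x *\<^sub>R (g x $ j * \<eta> x) = h j x * \<eta> x"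
        using hc[of j] by eventually_elim (simp add: mult.assoc)
    qed
    also have "\<dots> = (LINT x|lborel. h j x * \<eta> x)"
      by (intro integral_completion) simp
    finally show "(LINT x|lborel. indicator B x * u x * partial_deriv j \<eta> x) = - (LINT x|lborel. h j x * \<eta> x)" .
  qed
qed

text \<open>Testing the weak gradient against this kernel gives the derivative of the mollification
  at q; the condition on the ball around q is what restricts that identity to the interior of
  B.\<close>

lemma test_function_reflected_mollifier:
  fixes r :: "real^'n \<Rightarrow> real"
  assumes "\<And>k. C_k k r" "\<And>x. r x \<noteq> 0 \<Longrightarrow> norm x \<le> \<delta>" "cball q \<delta> \<subseteq> B"
  shows "test_function B (\<lambda>y. r (q - y))"
proof -
  have "C_k k (\<lambda>y. r (q - y))" for k
    using C_k_affine[OF assms(1), of k q "-1"] by simp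
  moreover have "closure {y. r (q - y) \<noteq> 0} \<subseteq> cball q \<delta>"
    using assms(2) by (intro closure_minimal) (auto simp: dist_norm)
  ultimately show ?thesis
    using assms(3) by (auto simp: test_function_def compact_eq_bounded_closed
        intro: bounded_subset[OF bounded_cball])
qed

lemma C_1_line_derivative:
  fixes r :: "real^'n \<Rightarrow> real"
  assumes "C_k 1 r"
  shows "((\<lambda>\<tau>. r (q + \<tau> *\<^sub>R v)) has_real_derivative
           (\<Sum>j\<in>UNIV. v $ j * partial_deriv j r (q + \<tau> *\<^sub>R v))) (at \<tau>)"
proof -
  let ?r' = "frechet_derivative r (at (q + \<tau> *\<^sub>R v))"
  have r': "(r has_derivative ?r') (at (q + \<tau> *\<^sub>R v))"
    using assms by (simp add: frechet_derivative_works[symmetric])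
  have lin: "linear ?r'" using r' by (rule has_derivative_linear)
  have "((\<lambda>\<tau>. q + \<tau> *\<^sub>R v) has_derivative (\<lambda>h. h *\<^sub>R v)) (at \<tau>)"
    by (auto intro!: derivative_eq_intros)
  from has_derivative_compose[OF this r']
  have "((\<lambda>\<tau>. r (q + \<tau> *\<^sub>R v)) has_derivative (\<lambda>h. ?r' (h *\<^sub>R v))) (at \<tau>)" .
  moreover have "?r' v = (\<Sum>j\<in>UNIV. v $ j * partial_deriv j r (q + \<tau> *\<^sub>R v))"
  proof -
    have "?r' v = ?r' (\<Sum>j\<in>UNIV. v $ j *\<^sub>R axis j 1)"
      using basis_expansion[of v] by (simp add: scalar_mult_eq_scaleR)
    then show ?thesis
      by (simp add: linear_sum[OF lin] linear_scale[OF lin] partial_deriv_def)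
  qed
  ultimately show ?thesis
    using linear_scale[OF lin] by (simp add: has_field_derivative_def mult.commute[of _ "sum _ _"])
qed

text \<open>A non-integrable function has Bochner integral 0 by convention, so the bound holds for
  it too. This spares proofs of integrability for h times the kernel.\<close>

lemma abs_integral_le_nn_integral:
  fixes f :: "'a \<Rightarrow> real"
  shows "ennreal \<bar>integral\<^sup>L M f\<bar> \<le> (\<integral>\<^sup>+x. ennreal \<bar>f x\<bar> \<partial>M)"
  using integral_norm_bound_ennreal[of M f] not_integrable_integral_eq[of M f]
  by (cases "integrable M f") auto

lemma integrable_bounded_times_reflected:
  fixes U f :: "'a::euclidean_space \<Rightarrow> real"
  assumes [measurable]: "U \<in> borel_measurable borel" and M: "\<And>y. \<bar>U y\<bar> \<le> M"
    and f: "continuous_on UNIV f" "\<And>w. norm w > \<delta> \<Longrightarrow> f w = 0"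
  shows "integrable lborel (\<lambda>y. U y * f (q - y))"
proof -
  have [measurable]: "f \<in> borel_measurable borel"
    using f(1) by (rule borel_measurable_continuous_onI)
  have "bounded (f ` cball 0 \<delta>)"
    by (intro compact_imp_bounded compact_continuous_image continuous_on_subset[OF f(1)]) auto
  then obtain b where "\<forall>z\<in>f ` cball 0 \<delta>. norm z \<le> b"
    unfolding bounded_iff ..
  then have b: "\<bar>f w\<bar> \<le> b" if "norm w \<le> \<delta>" for w
    using that by auto
  show ?thesis
  proof (rule integrableI_bounded_set[of "cball q \<delta>" _ _ "M * b"])
    show "AE y in lborel. y \<in> cball q \<delta> \<longrightarrow> norm (U y * f (q - y)) \<le> M * b"
      using M b by (auto simp: abs_mult dist_norm intro!: mult_mono intro: order_trans[OF abs_ge_zero M])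
    show "AE y in lborel. y \<notin> cball q \<delta> \<longrightarrow> U y * f (q - y) = 0"
      using f(2) by (force simp: dist_norm)
  qed (use emeasure_lborel_cball_finite[of q \<delta>] in auto)
qed

text \<open>For each fixed y the fundamental theorem of calculus is applied to the smooth kernel
  along the segment; Fubini exchanges the integrals over y and \<tau>, and \<open>weak\<close> then
  moves the derivative from the kernel to U. The mollification itself is never differentiated under
  the integral sign. No minus sign appears in \<open>weak\<close>, because reflecting the kernel
  changes the sign of its derivative once more.\<close>

lemma mollification_increment_le:
  fixes U r :: "real^'n \<Rightarrow> real" and h :: "'n \<Rightarrow> real^'n \<Rightarrow> real"
  assumes U [measurable]: "U \<in> borel_measurable borel" and M: "\<And>y. \<bar>U y\<bar> \<le> M"
    and r: "\<And>k. C_k k r" "\<And>x. r x \<ge> 0" "\<And>x. r x \<noteq> 0 \<Longrightarrow> norm x \<le> \<delta>"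
    and st: "s \<le> t"
    and weak: "\<And>\<tau> j. \<tau> \<in> {s..t} \<Longrightarrow>
      (LINT y|lborel. U y * partial_deriv j r (x + \<tau> *\<^sub>R v - y)) =
      (LINT y|lborel. h j y * r (x + \<tau> *\<^sub>R v - y))"
  shows "ennreal \<bar>(LINT y|lborel. U y * r (x + t *\<^sub>R v - y)) - (LINT y|lborel. U y * r (x + s *\<^sub>R v - y))\<bar>
    \<le> (\<integral>\<^sup>+\<tau>. indicator {s<..t} \<tau> *
         (\<Sum>j\<in>UNIV. ennreal \<bar>v $ j\<bar> * (\<integral>\<^sup>+y. ennreal (\<bar>h j y\<bar> * r (x + \<tau> *\<^sub>R v - y)) \<partial>lborel)) \<partial>lborel)"
proof -
  have contr: "continuous_on UNIV r" and contp: "continuous_on UNIV (partial_deriv j r)" for j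
  proof -
    have "C_k 1 r" "C_k 2 r" using r by auto
    then have "C_k 1 r" "C_k 1 (partial_deriv j r)" by (simp_all add: numeral_2_eq_2)
    then show "continuous_on UNIV r" "continuous_on UNIV (partial_deriv j r)"
      using C_k_continuous by blast+
  qed
  have [measurable]: "r \<in> borel_measurable borel" "partial_deriv j r \<in> borel_measurable borel" for j
    using contr contp borel_measurable_continuous_onI by auto
  have zero: "partial_deriv j r w = 0" if "norm w > \<delta>" for w j
  proof -
    have "(r has_derivative (\<lambda>_. 0)) (at w)"
    proof (rule has_derivative_transform_within_open[of "\<lambda>_. 0" _ _ _ "- cball 0 \<delta>"])
      show "0 = r y" if "y \<in> - cball 0 \<delta>" for y using that r(3)[of y] by force
    qed (use that in auto)
    then show ?thesis by (simp add: partial_derivI)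
  qed
  define D where "D \<tau> y = (\<Sum>j\<in>UNIV. v $ j * partial_deriv j r (x + \<tau> *\<^sub>R v - y))" for \<tau> y
  have Dcont: "continuous_on UNIV (\<lambda>z. D (fst z) (snd z))"
    unfolding D_def
    by (intro continuous_intros continuous_on_compose2[OF contp]) auto
  \<comment> \<open>The ball of radius R contains every y that the kernel reaches from some point x
    + \<tau> v of the segment: \<delta> is the radius of the kernel, and the other terms bound the
    norm of x + \<tau> v.\<close>
  define R where "R = \<delta> + norm x + (\<bar>s\<bar> + \<bar>t\<bar>) * norm v"
  have supp: "norm y \<le> R" if "norm (x + \<tau> *\<^sub>R v - y) \<le> \<delta>" "\<tau> \<in> {s..t}" for y \<tau>
  proof -
    have "norm y \<le> norm (x + \<tau> *\<^sub>R v - y) + norm x + norm (\<tau> *\<^sub>R v)"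
      using norm_triangle_ineq4[of "x + \<tau> *\<^sub>R v" "x + \<tau> *\<^sub>R v - y"] norm_triangle_ineq[of x "\<tau> *\<^sub>R v"]
      by simp
    moreover have "norm (\<tau> *\<^sub>R v) \<le> (\<bar>s\<bar> + \<bar>t\<bar>) * norm v"
      using that(2) by (auto intro!: mult_right_mono)
    ultimately show ?thesis using that(1) by (simp add: R_def)
  qed
  have D0: "D \<tau> y = 0" if "\<tau> \<in> {s..t}" "norm y > R" for \<tau> y
    unfolding D_def using supp[of \<tau> y] that zero by (intro sum.neutral) (auto simp: not_less[symmetric])
  let ?K = "{s..t} \<times> cball (0::real^'n) R"
  have intD: "integrable lborel (\<lambda>z. indicator ?K z *\<^sub>R D (fst z) (snd z))"
    by (intro borel_integrable_compact compact_Times continuous_on_subset[OF Dcont]) auto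
  have Dmeas: "(\<lambda>z. D (fst z) (snd z)) \<in> borel_measurable borel"
    using Dcont borel_measurable_continuous_onI by auto
  \<comment> \<open>U is merely bounded and Borel. The majorant for Fubini is M times the continuous
    function D cut off to a compact product, outside of which D vanishes for \<tau> in
    [s, t].\<close>
  have int: "integrable (lborel \<Otimes>\<^sub>M lborel) (\<lambda>(\<tau>, y). indicator {s..t} \<tau> * (U y * D \<tau> y))"
    unfolding lborel_prod
  proof (rule Bochner_Integration.integrable_bound[OF integrable_mult_right[OF intD, of M]])
    show "(\<lambda>(\<tau>, y). indicator {s..t} \<tau> * (U y * D \<tau> y)) \<in> borel_measurable lborel"
    proof -
      have fs: "fst \<in> borel_measurable (borel :: (real \<times> (real^'n)) measure)"
           "snd \<in> borel_measurable (borel :: (real \<times> (real^'n)) measure)"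
        by (auto intro!: borel_measurable_continuous_onI continuous_intros)
      have ind: "(indicator {s..t} :: real \<Rightarrow> real) \<in> borel_measurable borel" by simp
      have "(\<lambda>p. indicator {s..t} (fst p) * (U (snd p) * D (fst p) (snd p))) \<in> borel_measurable borel"
        using measurable_compose[OF fs(1) ind] measurable_compose[OF fs(2) U] Dmeas
        by (intro borel_measurable_times)
      then show ?thesis by (simp add: case_prod_beta)
    qed
    have "norm (indicator {s..t} \<tau> * (U y * D \<tau> y)) \<le> norm (M * (indicator ?K (\<tau>, y) *\<^sub>R D \<tau> y))" for \<tau> y
      using D0[of \<tau> y] M[of y] by (auto simp: indicator_def abs_mult intro!: mult_right_mono)
    then show "AE z in lborel. norm (case z of (\<tau>, y) \<Rightarrow> indicator {s..t} \<tau> * (U y * D \<tau> y)) \<le>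
        norm (M * (indicator ?K z *\<^sub>R D (fst z) (snd z)))"
      by auto
  qed
  have FTC: "(LINT \<tau>|lborel. indicator {s..t} \<tau> * (U y * D \<tau> y)) =
      U y * r (x + t *\<^sub>R v - y) - U y * r (x + s *\<^sub>R v - y)" for y
  proof -
    have "(LINT \<tau>|lborel. indicator {s..t} \<tau> *\<^sub>R (U y * D \<tau> y)) = U y * r (x + t *\<^sub>R v - y) - U y * r (x + s *\<^sub>R v - y)"
    proof (rule integral_FTC_atLeastAtMost[OF st])
      have shift: "x - y + \<tau> *\<^sub>R v = x + \<tau> *\<^sub>R v - y" for \<tau> by simp
      show "((\<lambda>\<tau>. U y * r (x + \<tau> *\<^sub>R v - y)) has_vector_derivative U y * D \<tau> y) (at \<tau> within {s..t})" for \<tau>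
        using DERIV_cmult[OF C_1_line_derivative[OF r(1), of "x - y" v \<tau>], of "U y"]
        unfolding D_def shift has_real_derivative_iff_has_vector_derivative
        by (rule has_vector_derivative_at_within)
      show "continuous_on {s..t} (\<lambda>\<tau>. U y * D \<tau> y)"
        by (intro continuous_intros continuous_on_compose2[OF Dcont, of _ "\<lambda>\<tau>. (\<tau>, y)", simplified])
    qed
    then show ?thesis by simp
  qed
  have intUr: "integrable lborel (\<lambda>y. U y * r (q - y))" for q
    using r(3) by (intro integrable_bounded_times_reflected[OF U M contr, of \<delta>]) force
  have intp: "integrable lborel (\<lambda>y. U y * partial_deriv j r (q - y))" for q j
    by (intro integrable_bounded_times_reflected[OF U M contp, of \<delta>] zero)
  have "(LINT y|lborel. U y * r (x + t *\<^sub>R v - y)) - (LINT y|lborel. U y * r (x + s *\<^sub>R v - y)) =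
      (LINT y|lborel. (LINT \<tau>|lborel. indicator {s..t} \<tau> * (U y * D \<tau> y)))"
    by (simp add: FTC intUr)
  also have "\<dots> = (LINT \<tau>|lborel. (LINT y|lborel. indicator {s..t} \<tau> * (U y * D \<tau> y)))"
    by (rule lborel_pair.Fubini_integral[OF int])
  also have "\<dots> = (LINT \<tau>|lborel. indicator {s..t} \<tau> * (\<Sum>j\<in>UNIV. v $ j * (LINT y|lborel. h j y * r (x + \<tau> *\<^sub>R v - y))))"
  proof (intro Bochner_Integration.integral_cong refl)
    fix \<tau>
    show "(LINT y|lborel. indicator {s..t} \<tau> * (U y * D \<tau> y)) = 
      indicator {s..t} \<tau> * (\<Sum>j\<in>UNIV. v $ j * (LINT y|lborel. h j y * r (x + \<tau> *\<^sub>R v - y)))"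
    proof (cases "\<tau> \<in> {s..t}")
      case True
      have "(LINT y|lborel. U y * D \<tau> y) =
          (LINT y|lborel. (\<Sum>j\<in>UNIV. v $ j * (U y * partial_deriv j r (x + \<tau> *\<^sub>R v - y))))"
        by (simp add: D_def sum_distrib_left mult_ac)
      also have "\<dots> = (\<Sum>j\<in>UNIV. v $ j * (LINT y|lborel. U y * partial_deriv j r (x + \<tau> *\<^sub>R v - y)))"
        by (subst Bochner_Integration.integral_sum) (auto intro!: intp)
      finally show ?thesis using True weak by simp
    qed simp
  qed
  finally have eq: "(LINT y|lborel. U y * r (x + t *\<^sub>R v - y)) - (LINT y|lborel. U y * r (x + s *\<^sub>R v - y)) = \<dots>" .
  let ?I = "\<lambda>j \<tau>. LINT y|lborel. h j y * r (x + \<tau> *\<^sub>R v - y)"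
  have "ennreal \<bar>LINT \<tau>|lborel. indicator {s..t} \<tau> * (\<Sum>j\<in>UNIV. v $ j * ?I j \<tau>)\<bar> \<le>
      (\<integral>\<^sup>+\<tau>. ennreal \<bar>indicator {s..t} \<tau> * (\<Sum>j\<in>UNIV. v $ j * ?I j \<tau>)\<bar> \<partial>lborel)"
    by (rule abs_integral_le_nn_integral)
  also have "\<dots> \<le> (\<integral>\<^sup>+\<tau>. indicator {s<..t} \<tau> *
         (\<Sum>j\<in>UNIV. ennreal \<bar>v $ j\<bar> * (\<integral>\<^sup>+y. ennreal (\<bar>h j y\<bar> * r (x + \<tau> *\<^sub>R v - y)) \<partial>lborel)) \<partial>lborel)"
  proof (rule nn_integral_mono_AE)
    \<comment> \<open>Dropping the null endpoint s gives a half-open interval, so that the bounds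
      for consecutive pieces of a partition add up as values of one measure.\<close>
    have "AE \<tau> in lborel. \<tau> \<noteq> s" by (rule AE_lborel_singleton)
    then show "AE \<tau> in lborel. ennreal \<bar>indicator {s..t} \<tau> * (\<Sum>j\<in>UNIV. v $ j * ?I j \<tau>)\<bar> \<le> 
        indicator {s<..t} \<tau> *
         (\<Sum>j\<in>UNIV. ennreal \<bar>v $ j\<bar> * (\<integral>\<^sup>+y. ennreal (\<bar>h j y\<bar> * r (x + \<tau> *\<^sub>R v - y)) \<partial>lborel))"
    proof eventually_elim
      case (elim \<tau>)
      have "ennreal \<bar>\<Sum>j\<in>UNIV. v $ j * ?I j \<tau>\<bar> \<le> ennreal (\<Sum>j\<in>UNIV. \<bar>v $ j\<bar> * \<bar>?I j \<tau>\<bar>)"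
        by (intro ennreal_leI order_trans[OF sum_abs]) (simp add: abs_mult)
      also have "\<dots> = (\<Sum>j\<in>UNIV. ennreal \<bar>v $ j\<bar> * ennreal \<bar>?I j \<tau>\<bar>)"
        by (simp add: sum_ennreal[symmetric] ennreal_mult)
      also have "\<dots> \<le> (\<Sum>j\<in>UNIV. ennreal \<bar>v $ j\<bar> * (\<integral>\<^sup>+y. ennreal (\<bar>h j y\<bar> * r (x + \<tau> *\<^sub>R v - y)) \<partial>lborel))"
        using abs_integral_le_nn_integral[of lborel "\<lambda>y. h _ y * r (x + \<tau> *\<^sub>R v - y)"] r(2)
        by (intro sum_mono mult_left_mono) (simp_all add: abs_mult)
      finally show ?case using elim by (auto simp: indicator_def)
    qed
  qed
  finally show ?thesis unfolding eq .
qed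


section \<open>Lengths of curves\<close>

lemma curve_length_le:
  assumes "\<And>N t. mono_on {..N} t \<Longrightarrow> t ` {..N} \<subseteq> {0..1} \<Longrightarrow>
     ennreal (\<Sum>i<N. dist (\<gamma> (t i)) (\<gamma> (t (Suc i)))) \<le> L"
  shows "curve_length \<gamma> \<le> L"
  unfolding curve_length_def by (rule Sup_least) (use assms in blast)

lemma le_curve_length:
  assumes "mono_on {..N} t" "t ` {..N} \<subseteq> {0..1}"
  shows "ennreal (\<Sum>i<N. dist (\<gamma> (t i)) (\<gamma> (t (Suc i)))) \<le> curve_length \<gamma>"
  unfolding curve_length_def by (rule Sup_upper) (use assms in blast)

lemma curve_length_reversepath_le: "curve_length (reversepath \<gamma>) \<le> curve_length \<gamma>"
proof (rule curve_length_le)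
  fix N and t :: "nat \<Rightarrow> real"
  assume t: "mono_on {..N} t" "t ` {..N} \<subseteq> {0..1}"
  \<comment> \<open>The partition read backwards in the reversed parameter, hence increasing
    again.\<close>
  define s where "s i = 1 - t (N - i)" for i
  have "(\<Sum>i<N. dist (reversepath \<gamma> (t i)) (reversepath \<gamma> (t (Suc i)))) =
      (\<Sum>i<N. dist (reversepath \<gamma> (t (N - Suc i))) (reversepath \<gamma> (t (Suc (N - Suc i)))))"
    by (rule sum.nat_diff_reindex[symmetric])
  also have "\<dots> = (\<Sum>i<N. dist (\<gamma> (s i)) (\<gamma> (s (Suc i))))"
    by (intro sum.cong refl) (simp add: reversepath_def s_def dist_commute Suc_diff_Suc)
  also have "ennreal \<dots> \<le> curve_length \<gamma>"
  proof (rule le_curve_length)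
    show "mono_on {..N} s"
      using t(1) by (auto simp: s_def mono_on_def)
    show "s ` {..N} \<subseteq> {0..1}"
      using t(2) by (auto simp: s_def image_subset_iff)
  qed
  finally show "ennreal (\<Sum>i<N. dist (reversepath \<gamma> (t i)) (reversepath \<gamma> (t (Suc i)))) \<le> curve_length \<gamma>" .
qed

lemma curve_length_joinpaths_le:
  assumes "pathfinish \<gamma>\<^sub>1 = pathstart \<gamma>\<^sub>2"
  shows "curve_length (\<gamma>\<^sub>1 +++ \<gamma>\<^sub>2) \<le> curve_length \<gamma>\<^sub>1 + curve_length \<gamma>\<^sub>2"
proof (rule curve_length_le)
  fix N and t :: "nat \<Rightarrow> real"
  assume t: "mono_on {..N} t" "t ` {..N} \<subseteq> {0..1}"
  \<comment> \<open>Each partition point is clipped at 1/2 from above and from below and rescaled to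
    the parameter of the corresponding half. Only a step that straddles 1/2 contributes to both
    sums, and there the triangle inequality is applied through the junction.\<close>
  define a b where "a i = 2 * min (t i) (1/2)" and "b i = 2 * max (t i) (1/2) - 1" for i
  let ?\<gamma> = "\<gamma>\<^sub>1 +++ \<gamma>\<^sub>2"
  have "dist (?\<gamma> (t i)) (?\<gamma> (t (Suc i))) \<le>
      dist (\<gamma>\<^sub>1 (a i)) (\<gamma>\<^sub>1 (a (Suc i))) + dist (\<gamma>\<^sub>2 (b i)) (\<gamma>\<^sub>2 (b (Suc i)))" if "i < N" for i
  proof -
    have "t i \<le> t (Suc i)"
      using t(1) that by (auto simp: mono_on_def)
    then consider "t (Suc i) \<le> 1/2" "t i \<le> 1/2" | "t i \<le> 1/2" "t (Suc i) > 1/2" | "t i > 1/2" "t (Suc i) > 1/2"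
      by linarith
    then show ?thesis
    proof cases
      case 2
      have "dist (\<gamma>\<^sub>1 (2 * t i)) (\<gamma>\<^sub>2 (2 * t (Suc i) - 1)) \<le>
          dist (\<gamma>\<^sub>1 (2 * t i)) (\<gamma>\<^sub>1 1) + dist (\<gamma>\<^sub>1 1) (\<gamma>\<^sub>2 (2 * t (Suc i) - 1))"
        by (rule dist_triangle)
      with 2 assms show ?thesis
        by (simp add: a_def b_def joinpaths_def pathfinish_def pathstart_def min_def max_def)
    qed (simp_all add: a_def b_def joinpaths_def min_def max_def)
  qed
  then have "(\<Sum>i<N. dist (?\<gamma> (t i)) (?\<gamma> (t (Suc i)))) \<le>
      (\<Sum>i<N. dist (\<gamma>\<^sub>1 (a i)) (\<gamma>\<^sub>1 (a (Suc i)))) + (\<Sum>i<N. dist (\<gamma>\<^sub>2 (b i)) (\<gamma>\<^sub>2 (b (Suc i))))"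
    by (auto simp flip: sum.distrib intro: sum_mono)
  then have "ennreal (\<Sum>i<N. dist (?\<gamma> (t i)) (?\<gamma> (t (Suc i)))) \<le>
      ennreal (\<Sum>i<N. dist (\<gamma>\<^sub>1 (a i)) (\<gamma>\<^sub>1 (a (Suc i)))) + ennreal (\<Sum>i<N. dist (\<gamma>\<^sub>2 (b i)) (\<gamma>\<^sub>2 (b (Suc i))))"
    by (subst ennreal_plus[symmetric]) (auto intro: sum_nonneg ennreal_leI)
  also have "\<dots> \<le> curve_length \<gamma>\<^sub>1 + curve_length \<gamma>\<^sub>2"
  proof (intro add_mono le_curve_length)
    show "mono_on {..N} a" "mono_on {..N} b"
      using t(1) by (fastforce simp: a_def b_def mono_on_def min_def max_def)+
    show "a ` {..N} \<subseteq> {0..1}" "b ` {..N} \<subseteq> {0..1}"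
      using t(2) by (auto simp: a_def b_def image_subset_iff min_def max_def)
  qed
  finally show "ennreal (\<Sum>i<N. dist (?\<gamma> (t i)) (?\<gamma> (t (Suc i)))) \<le> curve_length \<gamma>\<^sub>1 + curve_length \<gamma>\<^sub>2" .
qed

text \<open>\<open>\<mu> k\<close> plays the role of the length measure of the approximating curve \<open>\<Gamma> k\<close>.\<close>

lemma curve_length_le_liminf:
  fixes \<gamma> :: "real \<Rightarrow> 'a::metric_space" and \<mu> :: "nat \<Rightarrow> real measure"
  assumes lim: "\<And>t. t \<in> {0..1} \<Longrightarrow> (\<lambda>k. \<Gamma> k t) \<longlonglongrightarrow> \<gamma> t"
    and sets: "\<And>k. sets (\<mu> k) = sets borel"
    and le: "\<forall>\<^sub>F k in sequentially. \<forall>s t. 0 \<le> s \<longrightarrow> s \<le> t \<longrightarrow> t \<le> 1 \<longrightarrow>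
       ennreal (dist (\<Gamma> k s) (\<Gamma> k t)) \<le> emeasure (\<mu> k) {s<..t}"
  shows "curve_length \<gamma> \<le> liminf (\<lambda>k. emeasure (\<mu> k) {0<..1})"
proof (rule curve_length_le)
  fix N and t :: "nat \<Rightarrow> real"
  assume t: "mono_on {..N} t" "t ` {..N} \<subseteq> {0..1}"
  \<comment> \<open>For a fixed partition the finite sum of distances converges. The supremum over
    partitions is taken only afterwards, which is why length is lower semicontinuous and no more is
    claimed.\<close>
  have "(\<lambda>k. \<Sum>i<N. dist (\<Gamma> k (t i)) (\<Gamma> k (t (Suc i)))) \<longlonglongrightarrow> (\<Sum>i<N. dist (\<gamma> (t i)) (\<gamma> (t (Suc i))))"
    using t(2) by (intro tendsto_sum tendsto_dist lim) (auto simp: image_subset_iff)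
  then have "(\<lambda>k. ennreal (\<Sum>i<N. dist (\<Gamma> k (t i)) (\<Gamma> k (t (Suc i))))) \<longlonglongrightarrow>
      ennreal (\<Sum>i<N. dist (\<gamma> (t i)) (\<gamma> (t (Suc i))))"
    by (rule tendsto_ennrealI)
  then have "ennreal (\<Sum>i<N. dist (\<gamma> (t i)) (\<gamma> (t (Suc i)))) = 
      liminf (\<lambda>k. ennreal (\<Sum>i<N. dist (\<Gamma> k (t i)) (\<Gamma> k (t (Suc i)))))"
    by (intro lim_imp_Liminf[symmetric]) auto
  also have "\<dots> \<le> liminf (\<lambda>k. emeasure (\<mu> k) {0<..1})"
  proof (rule Liminf_mono, use le in eventually_elim)
    case (elim k)
    \<comment> \<open>Consecutive half-open intervals are disjoint, so the bounds for the single
      steps combine into the measure of one interval.\<close>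
    have step: "ennreal (\<Sum>i<n. dist (\<Gamma> k (t i)) (\<Gamma> k (t (Suc i)))) \<le> emeasure (\<mu> k) {t 0<..t n}"
      if "n \<le> N" for n
      using that
    proof (induction n)
      case (Suc n)
      have mono: "t 0 \<le> t n" "t n \<le> t (Suc n)"
        using t(1) Suc.prems by (auto simp: mono_on_def)
      have rng: "0 \<le> t n" "t (Suc n) \<le> 1" using t(2) Suc.prems by (auto simp: image_subset_iff)
      have "ennreal (\<Sum>i<Suc n. dist (\<Gamma> k (t i)) (\<Gamma> k (t (Suc i)))) =
        ennreal (\<Sum>i<n. dist (\<Gamma> k (t i)) (\<Gamma> k (t (Suc i)))) + ennreal (dist (\<Gamma> k (t n)) (\<Gamma> k (t (Suc n))))"
        by (simp add: sum_nonneg)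
      also have "\<dots> \<le> emeasure (\<mu> k) {t 0<..t n} + emeasure (\<mu> k) {t n<..t (Suc n)}"
        using Suc elim rng mono by (intro add_mono) auto
      also have "\<dots> = emeasure (\<mu> k) ({t 0<..t n} \<union> {t n<..t (Suc n)})"
        by (intro plus_emeasure) (auto simp: sets)
      also have "{t 0<..t n} \<union> {t n<..t (Suc n)} = {t 0<..t (Suc n)}"
        using mono by auto
      finally show ?case .
    qed simp
    have "0 \<le> t 0" "t N \<le> 1" using t(2) by (auto simp: image_subset_iff)
    then have "emeasure (\<mu> k) {t 0<..t N} \<le> emeasure (\<mu> k) {0<..1}"
      by (intro emeasure_mono) (auto simp: sets)
    with step[of N] show ?case by (auto intro: order_trans)
  qed
  finally show "ennreal (\<Sum>i<N. dist (\<gamma> (t i)) (\<gamma> (t (Suc i)))) \<le> liminf (\<lambda>k. emeasure (\<mu> k) {0<..1})" .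
qed

lemma geodesic_dist_le:
  assumes "path \<gamma>" "path_image \<gamma> \<subseteq> D" "pathstart \<gamma> = x" "pathfinish \<gamma> = y"
  shows "geodesic_dist D x y \<le> curve_length \<gamma>"
  unfolding geodesic_dist_def by (rule Inf_lower) (use assms in blast)


section \<open>Averages over segments\<close>

lemma nn_integral_lborel_affine:
  fixes f :: "'a::euclidean_space \<Rightarrow> ennreal"
  assumes [measurable]: "f \<in> borel_measurable borel" and "c \<noteq> 0"
  shows "(\<integral>\<^sup>+x. f (t + c *\<^sub>R x) \<partial>lborel) = ennreal (inverse (\<bar>c\<bar> ^ DIM('a))) * (\<integral>\<^sup>+x. f x \<partial>lborel)"
proof -
  have "(\<integral>\<^sup>+x. f x \<partial>lborel) = ennreal (\<bar>c\<bar> ^ DIM('a)) * (\<integral>\<^sup>+x. f (t + c *\<^sub>R x) \<partial>lborel)"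
    by (subst lborel_affine[OF \<open>c \<noteq> 0\<close>, of t])
       (simp add: nn_integral_density nn_integral_distr nn_integral_cmult)
  then show ?thesis
    using \<open>c \<noteq> 0\<close> by (simp add: mult.assoc[symmetric] ennreal_mult[symmetric])
qed

lemma lborel_distr_reflect: "distr lborel borel (\<lambda>y. q - y) = (lborel :: 'a::euclidean_space measure)"
  using lborel_affine[of "-1" q] by (simp add: density_1)

lemma nn_integral_powr_from_0:
  assumes "a > -1"
  shows "(\<integral>\<^sup>+\<tau>. indicator {0..1} \<tau> * ennreal (\<tau> powr a) \<partial>lborel) = ennreal (1 / (a + 1))"
proof -
  have "((\<lambda>\<tau>. indicator {0..1} \<tau> * \<tau> powr a) has_integral 1 / (a + 1)) UNIV"
  proof -
    have "((\<lambda>\<tau>. \<tau> powr a) has_integral 1 / (a + 1)) {0..1}"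
      using has_integral_powr_from_0[OF assms, of 1] by simp
    then have "((\<lambda>\<tau>. if \<tau> \<in> {0..1} then \<tau> powr a else 0) has_integral 1 / (a + 1)) UNIV"
      by (simp only: has_integral_restrict_UNIV)
    then show ?thesis
      by (rule has_integral_eq[rotated]) (simp add: indicator_def)
  qed
  from nn_integral_has_integral_lborel[OF _ _ this]
  show ?thesis
    by (simp add: ennreal_mult' indicator_def of_bool_def if_distrib[of ennreal] if_distrib[of "\<lambda>x. x * _"] cong: if_cong)
qed

text \<open>Above the threshold, a is the product of a powr (1 - p) and a powr p, and the first
  factor decreases in a. This additive bound does the work of Hoelder's inequality: A will be chosen
  as a power of \<tau>.\<close>

lemma le_powr_threshold:
  fixes a A p :: real
  assumes "a \<ge> 0" "A > 0" "p \<ge> 1"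
  shows "a \<le> A + A powr (1 - p) * a powr p"
proof (cases "a \<le> A")
  case False
  have "A powr (1 - p) * a powr p \<ge> a powr (1 - p) * a powr p"
    using False assms by (intro mult_right_mono powr_mono2') auto
  also have "a powr (1 - p) * a powr p = a"
    using False assms by (simp flip: powr_add)
  finally show ?thesis using assms by linarith
qed (use assms in \<open>simp add: add_increasing2\<close>)

text \<open>Splitting the values of \<open>h\<close> at the threshold \<open>\<tau> powr -\<alpha>\<close>, with
  \<open>(n - 1) / (p - 1) < \<alpha> < 1\<close>, bounds the inner integral by
  \<open>V \<tau> powr -\<alpha> + M \<tau> powr (\<alpha> (p - 1) - n)\<close>, and both exponents exceed \<open>-1\<close>;
  this is where \<open>p > n\<close> enters.\<close>

lemma segment_average_bounded:
  fixes h :: "'a::euclidean_space \<Rightarrow> real" and p :: real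
  assumes [measurable]: "h \<in> borel_measurable borel"
    and p: "p > DIM('a)"
    and M: "(\<integral>\<^sup>+x. ennreal (\<bar>h x\<bar> powr p) \<partial>lborel) < \<infinity>"
  obtains C where "C < \<infinity>"
    "\<And>q x. (\<integral>\<^sup>+\<tau>. \<integral>\<^sup>+z. indicator {0<..1} \<tau> * indicator (ball 0 1) z *
        ennreal \<bar>h (q + \<tau> *\<^sub>R (z - x))\<bar> \<partial>lborel \<partial>lborel) \<le> C"
proof -
  let ?n = "real DIM('a)"
  have n1: "?n \<ge> 1" using DIM_positive[where 'a='a] by linarith
  with p have p1: "p > 1" by linarith
  have "(?n - 1) / (p - 1) < 1" using p p1 by (subst divide_less_eq_1_pos) auto
  then obtain \<alpha> where \<alpha>: "(?n - 1) / (p - 1) < \<alpha>" "\<alpha> < 1" using dense by blast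
  define \<beta> where "\<beta> = \<alpha> * (p - 1) - ?n"
  have \<beta>: "\<beta> > -1" using \<alpha> p n1 by (simp add: \<beta>_def field_simps)
  define V where "V = emeasure lborel (ball (0::'a) 1)"
  define M' where "M' = (\<integral>\<^sup>+x. ennreal (\<bar>h x\<bar> powr p) \<partial>lborel)"
  \<comment> \<open>The two factors are the integrals over [0, 1] of \<tau> powr -\<alpha> and of
    \<tau> powr \<beta>.\<close>
  define C where "C = ennreal (1 / (1 - \<alpha>)) * V + ennreal (1 / (\<beta> + 1)) * M'"
  have "V < \<infinity>" unfolding V_def using emeasure_lborel_ball_finite by simp
  then have "C < \<infinity>" using M by (simp add: C_def M'_def ennreal_mult_less_top)
  moreover have "(\<integral>\<^sup>+\<tau>. \<integral>\<^sup>+z. indicator {0<..1} \<tau> * indicator (ball 0 1) z *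
        ennreal \<bar>h (q + \<tau> *\<^sub>R (z - x))\<bar> \<partial>lborel \<partial>lborel) \<le> C" for q x
  proof -
    have "(\<integral>\<^sup>+z. indicator {0<..1} \<tau> * indicator (ball 0 1) z * ennreal \<bar>h (q + \<tau> *\<^sub>R (z - x))\<bar> \<partial>lborel) \<le>
        indicator {0..1} \<tau> * ennreal (\<tau> powr (- \<alpha>)) * V + indicator {0..1} \<tau> * ennreal (\<tau> powr \<beta>) * M'" for \<tau>
    proof (cases "\<tau> \<in> {0<..1}")
      case True
      then have \<tau>: "\<tau> > 0" by simp
      have "(\<integral>\<^sup>+z. indicator (ball 0 1) z * ennreal \<bar>h (q + \<tau> *\<^sub>R (z - x))\<bar> \<partial>lborel) \<le>
        (\<integral>\<^sup>+z. ennreal (\<tau> powr (- \<alpha>)) * indicator (ball 0 1) z +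
           ennreal (\<tau> powr (\<alpha> * (p - 1))) * ennreal (\<bar>h ((q - \<tau> *\<^sub>R x) + \<tau> *\<^sub>R z)\<bar> powr p) \<partial>lborel)"
      proof (intro nn_integral_mono)
        fix z :: 'a
        let ?a = "\<bar>h (q + \<tau> *\<^sub>R (z - x))\<bar>"
        have "?a \<le> \<tau> powr (- \<alpha>) + (\<tau> powr (- \<alpha>)) powr (1 - p) * ?a powr p"
          using \<tau> p1 by (intro le_powr_threshold) auto
        also have "(\<tau> powr (- \<alpha>)) powr (1 - p) = \<tau> powr (\<alpha> * (p - 1))"
          by (simp add: powr_powr algebra_simps)
        also have "q + \<tau> *\<^sub>R (z - x) = (q - \<tau> *\<^sub>R x) + \<tau> *\<^sub>R z"
          by (simp add: algebra_simps)
        finally have "ennreal \<bar>h ((q - \<tau> *\<^sub>R x) + \<tau> *\<^sub>R z)\<bar> \<le> ennreal (\<tau> powr (- \<alpha>)) +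
            ennreal (\<tau> powr (\<alpha> * (p - 1))) * ennreal (\<bar>h ((q - \<tau> *\<^sub>R x) + \<tau> *\<^sub>R z)\<bar> powr p)"
          by (simp flip: ennreal_mult ennreal_plus)
        then show "indicator (ball 0 1) z * ennreal ?a \<le> ennreal (\<tau> powr (- \<alpha>)) * indicator (ball 0 1) z +
           ennreal (\<tau> powr (\<alpha> * (p - 1))) * ennreal (\<bar>h ((q - \<tau> *\<^sub>R x) + \<tau> *\<^sub>R z)\<bar> powr p)"
          by (cases "z \<in> ball 0 1") (simp_all add: algebra_simps)
      qed
      also have "\<dots> = ennreal (\<tau> powr (- \<alpha>)) * V + ennreal (\<tau> powr (\<alpha> * (p - 1))) *
          (\<integral>\<^sup>+z. ennreal (\<bar>h ((q - \<tau> *\<^sub>R x) + \<tau> *\<^sub>R z)\<bar> powr p) \<partial>lborel)"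
      proof -
        have b: "(indicator (ball 0 1) :: 'a \<Rightarrow> ennreal) \<in> borel_measurable lborel"
          by (rule borel_measurable_indicator) simp
        have hm: "(\<lambda>z. ennreal (\<bar>h ((q - \<tau> *\<^sub>R x) + \<tau> *\<^sub>R z)\<bar> powr p)) \<in> borel_measurable lborel"
          by measurable
        show ?thesis
          by (simp only: nn_integral_add[OF borel_measurable_times_ennreal[OF borel_measurable_const b]
                borel_measurable_times_ennreal[OF borel_measurable_const hm]]
              nn_integral_cmult[OF b] nn_integral_cmult[OF hm] V_def)
            (simp only: nn_integral_indicator sets_lborel borel_open open_ball)
      qed
      \<comment> \<open>In the p-th power part the integral over z was enlarged to the whole space,
        so this substitution gives a value independent of q and x. Its price \<tau>^(-n) is the n
        subtracted in \<beta>.\<close>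
      also have "(\<integral>\<^sup>+z. ennreal (\<bar>h ((q - \<tau> *\<^sub>R x) + \<tau> *\<^sub>R z)\<bar> powr p) \<partial>lborel) =
          ennreal (inverse (\<tau> ^ DIM('a))) * M'"
        using nn_integral_lborel_affine[of "\<lambda>x. ennreal (\<bar>h x\<bar> powr p)" \<tau>] \<tau> by (simp add: M'_def)
      also have "ennreal (\<tau> powr (\<alpha> * (p - 1))) * (ennreal (inverse (\<tau> ^ DIM('a))) * M') = ennreal (\<tau> powr \<beta>) * M'"
        using \<tau> by (simp add: \<beta>_def powr_diff powr_realpow divide_inverse ennreal_mult mult.assoc)
      finally show ?thesis using True by simp
    qed simp
    then have "(\<integral>\<^sup>+\<tau>. \<integral>\<^sup>+z. indicator {0<..1} \<tau> * indicator (ball 0 1) z *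
        ennreal \<bar>h (q + \<tau> *\<^sub>R (z - x))\<bar> \<partial>lborel \<partial>lborel) \<le>
        (\<integral>\<^sup>+\<tau>. indicator {0..1} \<tau> * ennreal (\<tau> powr (- \<alpha>)) * V + indicator {0..1} \<tau> * ennreal (\<tau> powr \<beta>) * M' \<partial>lborel)"
      by (rule nn_integral_mono)
    also have "\<dots> = C"
      using nn_integral_powr_from_0[of "-\<alpha>"] nn_integral_powr_from_0[OF \<beta>] \<alpha>(2)
      by (simp add: nn_integral_add nn_integral_multc C_def)
    finally show ?thesis .
  qed
  ultimately show ?thesis by (rule that)
qed

text \<open>The convolution of |h| with r, integrated along the segment from x to z in the parameter
  \<tau>; the speed of the parametrization is left out and is bounded separately.\<close>

definition segment_integral :: "('a \<Rightarrow> real) \<Rightarrow> ('a \<Rightarrow> real) \<Rightarrow> 'a \<Rightarrow> 'a::euclidean_space \<Rightarrow> ennreal" where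
  "segment_integral r h x z =
     (\<integral>\<^sup>+\<tau>. indicator {0<..1} \<tau> * (\<integral>\<^sup>+y. ennreal (\<bar>h y\<bar> * r (x + \<tau> *\<^sub>R (z - x) - y)) \<partial>lborel) \<partial>lborel)"

lemma borel_measurable_segment_integral [measurable]:
  assumes [measurable]: "r \<in> borel_measurable borel" "h \<in> borel_measurable borel"
  shows "segment_integral r h x \<in> borel_measurable borel"
  unfolding segment_integral_def by measurable

text \<open>The convolution is an average, with weight \<open>r w\<close>, of translates of |h| by
  w. A translation only changes the base point q into x - w, and the bound C is uniform in q; since
  r has integral 1, C survives the averaging. This is why q and x are independent in the
  hypothesis.\<close>

lemma segment_integral_average_le:
  fixes h r :: "'a::euclidean_space \<Rightarrow> real"
  assumes [measurable]: "r \<in> borel_measurable borel" "h \<in> borel_measurable borel"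
    and r: "\<And>x. r x \<ge> 0" "integrable lborel r" "(LINT x|lborel. r x) = 1"
    and C: "\<And>q x. (\<integral>\<^sup>+\<tau>. \<integral>\<^sup>+z. indicator {0<..1} \<tau> * indicator (ball 0 1) z *
        ennreal \<bar>h (q + \<tau> *\<^sub>R (z - x))\<bar> \<partial>lborel \<partial>lborel) \<le> C"
  shows "(\<integral>\<^sup>+z. indicator (ball 0 1) z * segment_integral r h x z \<partial>lborel) \<le> C"
proof -
  define b :: "'a \<Rightarrow> ennreal" where "b = indicator (ball 0 1)"
  have [measurable]: "b \<in> borel_measurable borel" 
    unfolding b_def by (rule borel_measurable_indicator) simp
  define F where "F w \<tau> z = indicator {0<..1} \<tau> * b z *
        ennreal \<bar>h (x - w + \<tau> *\<^sub>R (z - x))\<bar>" for w z :: 'a and \<tau> :: real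
  have [measurable (raw)]: "(\<lambda>x. F (f x) (g x) (k x)) \<in> borel_measurable N"
    if [measurable]: "f \<in> borel_measurable N" "g \<in> borel_measurable N" "k \<in> borel_measurable N"
    for N :: "'b measure" and f g k
    unfolding F_def by measurable
  have inner: "(\<integral>\<^sup>+y. ennreal (\<bar>h y\<bar> * r (c - y)) \<partial>lborel) = (\<integral>\<^sup>+w. ennreal (r w) * ennreal \<bar>h (c - w)\<bar> \<partial>lborel)" for c
    using nn_integral_lborel_affine[of "\<lambda>y. ennreal (\<bar>h y\<bar> * r (c - y))" "-1" c] r(1)
    by (simp add: ennreal_mult' mult.commute)
  have "(\<integral>\<^sup>+z. indicator (ball 0 1) z * segment_integral r h x z \<partial>lborel) =
      (\<integral>\<^sup>+z. \<integral>\<^sup>+\<tau>. \<integral>\<^sup>+w. ennreal (r w) * F w \<tau> z \<partial>lborel \<partial>lborel \<partial>lborel)"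
  proof (rule nn_integral_cong)
    fix z
    have "(\<integral>\<^sup>+w. ennreal (r w) * F w \<tau> z \<partial>lborel) = b z * (indicator {0<..1} \<tau> *
        (\<integral>\<^sup>+w. ennreal (r w) * ennreal \<bar>h (x + \<tau> *\<^sub>R (z - x) - w)\<bar> \<partial>lborel))" for \<tau>
    proof -
      have "ennreal (r w) * F w \<tau> z =
          (b z * indicator {0<..1} \<tau>) * (ennreal (r w) * ennreal \<bar>h (x + \<tau> *\<^sub>R (z - x) - w)\<bar>)" for w
      proof -
        have shift: "x - w + \<tau> *\<^sub>R (z - x) = x + \<tau> *\<^sub>R (z - x) - w" by simp
        show ?thesis unfolding F_def shift by (simp only: mult_ac)
      qed
      then show ?thesis by (simp add: nn_integral_cmult mult.assoc)
    qed
    then show "indicator (ball 0 1) z * segment_integral r h x z =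
        (\<integral>\<^sup>+\<tau>. \<integral>\<^sup>+w. ennreal (r w) * F w \<tau> z \<partial>lborel \<partial>lborel)"
      unfolding segment_integral_def inner by (simp add: nn_integral_cmult b_def)
  qed
  \<comment> \<open>Three exchanges bring w outermost and z innermost, the order required by the
    bound C. All integrands are non-negative, so only joint measurability has to be checked.\<close>
  also have "\<dots> = (\<integral>\<^sup>+z. \<integral>\<^sup>+w. \<integral>\<^sup>+\<tau>. ennreal (r w) * F w \<tau> z \<partial>lborel \<partial>lborel \<partial>lborel)"
  proof (rule nn_integral_cong)
    fix z
    have "(\<lambda>(w, \<tau>). ennreal (r w) * F w \<tau> z) \<in> borel_measurable (lborel \<Otimes>\<^sub>M lborel)"
      by measurable
    then show "(\<integral>\<^sup>+\<tau>. \<integral>\<^sup>+w. ennreal (r w) * F w \<tau> z \<partial>lborel \<partial>lborel) =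
        (\<integral>\<^sup>+w. \<integral>\<^sup>+\<tau>. ennreal (r w) * F w \<tau> z \<partial>lborel \<partial>lborel)"
      by (rule lborel_pair.Fubini')
  qed
  also have "\<dots> = (\<integral>\<^sup>+w. \<integral>\<^sup>+z. \<integral>\<^sup>+\<tau>. ennreal (r w) * F w \<tau> z \<partial>lborel \<partial>lborel \<partial>lborel)"
  proof (rule lborel_pair.Fubini')
    have "(\<lambda>(p, \<tau>). ennreal (r (fst p)) * F (fst p) \<tau> (snd p)) \<in> borel_measurable ((borel \<Otimes>\<^sub>M borel) \<Otimes>\<^sub>M lborel)"
      by measurable
    then have "(\<lambda>p. \<integral>\<^sup>+\<tau>. ennreal (r (fst p)) * F (fst p) \<tau> (snd p) \<partial>lborel) \<in> borel_measurable (borel \<Otimes>\<^sub>M borel)"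
      by (rule lborel.borel_measurable_nn_integral)
    then show "(\<lambda>(w, z). \<integral>\<^sup>+\<tau>. ennreal (r w) * F w \<tau> z \<partial>lborel) \<in> borel_measurable (lborel \<Otimes>\<^sub>M lborel)"
      by (simp add: case_prod_beta cong: measurable_cong_sets)
  qed
  also have "\<dots> = (\<integral>\<^sup>+w. \<integral>\<^sup>+\<tau>. \<integral>\<^sup>+z. ennreal (r w) * F w \<tau> z \<partial>lborel \<partial>lborel \<partial>lborel)"
  proof (rule nn_integral_cong)
    fix w
    have "(\<lambda>(\<tau>, z). ennreal (r w) * F w \<tau> z) \<in> borel_measurable (lborel \<Otimes>\<^sub>M lborel)"
      by measurable
    then show "(\<integral>\<^sup>+z. \<integral>\<^sup>+\<tau>. ennreal (r w) * F w \<tau> z \<partial>lborel \<partial>lborel) =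
        (\<integral>\<^sup>+\<tau>. \<integral>\<^sup>+z. ennreal (r w) * F w \<tau> z \<partial>lborel \<partial>lborel)"
      by (rule lborel_pair.Fubini')
  qed
  also have "\<dots> = (\<integral>\<^sup>+w. ennreal (r w) * (\<integral>\<^sup>+\<tau>. \<integral>\<^sup>+z. F w \<tau> z \<partial>lborel \<partial>lborel) \<partial>lborel)"
    by (simp add: nn_integral_cmult)
  also have "\<dots> \<le> (\<integral>\<^sup>+w. ennreal (r w) * C \<partial>lborel)"
    unfolding F_def b_def by (intro nn_integral_mono mult_left_mono C) auto
  also have "\<dots> = C"
    using r by (simp add: nn_integral_multc nn_integral_eq_integral)
  finally show ?thesis .
qed

section \<open>Pointwise convergence of mollifications\<close>

lemma mollification_close:
  fixes U r :: "'a::euclidean_space \<Rightarrow> real"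
  assumes r: "\<And>x. r x \<ge> 0" "integrable lborel r" "(LINT x|lborel. r x) = 1"
      "\<And>x. r x \<noteq> 0 \<Longrightarrow> norm x \<le> \<delta>"
    and int: "integrable lborel (\<lambda>y. U y * r (q - y))"
    and close: "\<And>y. dist y q \<le> \<delta> \<Longrightarrow> \<bar>U y - U q\<bar> \<le> e"
  shows "\<bar>(LINT y|lborel. U y * r (q - y)) - U q\<bar> \<le> e"
proof -
  have [measurable]: "r \<in> borel_measurable borel" using r(2) by auto
  have intr: "integrable lborel (\<lambda>y. r (q - y))"
    using r(2) by (subst (asm) lborel_distr_reflect[of q, symmetric], subst (asm) integrable_distr_eq) auto
  have 1: "(LINT y|lborel. r (q - y)) = 1"
    using r(3) by (subst (asm) lborel_distr_reflect[of q, symmetric], subst (asm) integral_distr) auto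
  have "(LINT y|lborel. U y * r (q - y)) - U q = (LINT y|lborel. U y * r (q - y) - U q * r (q - y))"
    using int intr 1 by simp
  also have "\<bar>\<dots>\<bar> \<le> (LINT y|lborel. \<bar>U y * r (q - y) - U q * r (q - y)\<bar>)"
    by (rule integral_abs_bound)
  also have "\<dots> \<le> (LINT y|lborel. e * r (q - y))"
  proof (rule integral_mono)
    show "\<bar>U y * r (q - y) - U q * r (q - y)\<bar> \<le> e * r (q - y)" for y
      using close[of y] r(1)[of "q - y"] r(4)[of "q - y"]
      by (cases "r (q - y) = 0")
         (auto simp: dist_norm norm_minus_commute abs_mult left_diff_distrib[symmetric] intro!: mult_right_mono)
  qed (use int intr in auto)
  also have "\<dots> = e" using 1 by simp
  finally show ?thesis .
qed


section \<open>Images of segments under Sobolev maps\<close>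

lemma partial_deriv_reflected:
  fixes r :: "real^'n \<Rightarrow> real"
  assumes "C_k 1 r"
  shows "partial_deriv j (\<lambda>y. r (q - y)) y = - partial_deriv j r (q - y)"
  using partial_deriv_affine(2)[of r q "-1" y j] assms by simp

text \<open>Continuity at the single point q suffices, because lower semicontinuity of length asks
  only for pointwise convergence of the curves.\<close>

lemma mollification_tendsto:
  fixes U :: "'a::euclidean_space \<Rightarrow> real" and r :: "nat \<Rightarrow> 'a \<Rightarrow> real"
  assumes r: "\<And>k x. r k x \<ge> 0" "\<And>k. integrable lborel (r k)" "\<And>k. (LINT x|lborel. r k x) = 1"
      "\<And>k x. r k x \<noteq> 0 \<Longrightarrow> norm x \<le> \<delta> k"
    and \<delta>: "\<delta> \<longlonglongrightarrow> 0"
    and int: "\<And>k. integrable lborel (\<lambda>y. U y * r k (q - y))"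
    and cont: "isCont U q"
  shows "(\<lambda>k. LINT y|lborel. U y * r k (q - y)) \<longlonglongrightarrow> U q"
proof (rule tendstoI)
  fix e :: real assume e: "e > 0"
  from cont obtain d where d: "d > 0" "\<And>y. dist y q < d \<Longrightarrow> dist (U y) (U q) < e / 2"
    using e by (auto simp: continuous_at_eps_delta dest!: spec[of _ "e/2"])
  have "\<forall>\<^sub>F k in sequentially. \<delta> k < d"
    using \<delta> d(1) by (rule order_tendstoD)
  then show "\<forall>\<^sub>F k in sequentially. dist (LINT y|lborel. U y * r k (q - y)) (U q) < e"
  proof eventually_elim
    case (elim k)
    have "\<bar>(LINT y|lborel. U y * r k (q - y)) - U q\<bar> \<le> e / 2"
    proof (rule mollification_close[OF r int])
      show "\<bar>U y - U q\<bar> \<le> e / 2" if "dist y q \<le> \<delta> k" for y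
        using d(2)[of y] elim that by (simp add: dist_real_def)
    qed
    then show ?case using e by (simp add: dist_real_def)
  qed
qed

text \<open>Lower semicontinuity of length transfers the estimate from the mollified maps to
  \<open>\<phi>\<close> itself, so absolute continuity on almost every segment is not needed.\<close>

lemma image_segment_length_le:
  fixes \<phi> :: "real^'n \<Rightarrow> real^'n" and h :: "'n \<Rightarrow> 'n \<Rightarrow> real^'n \<Rightarrow> real"
    and r :: "nat \<Rightarrow> real^'n \<Rightarrow> real"
  defines "B \<equiv> ball (0::real^'n) 1"
  assumes cont: "continuous_on B \<phi>" and bdd: "bounded (\<phi> ` B)"
    and h [measurable]: "\<And>i j. h i j \<in> borel_measurable borel"
    and weak: "\<And>i j \<eta>. test_function B \<eta> \<Longrightarrow>
       (LINT x|lborel. indicator B x * \<phi> x $ i * partial_deriv j \<eta> x) = - (LINT x|lborel. h i j x * \<eta> x)"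
    and r: "\<And>m k. C_k m (r k)" "\<And>k x. r k x \<ge> 0" "\<And>k. integrable lborel (r k)"
      "\<And>k. (LINT x|lborel. r k x) = 1" "\<And>k x. r k x \<noteq> 0 \<Longrightarrow> norm x \<le> \<delta> k"
    and \<delta>: "\<delta> \<longlonglongrightarrow> 0"
    and x: "x \<in> B" and z: "z \<in> B"
  shows "curve_length (\<phi> \<circ> linepath x z) \<le>
    liminf (\<lambda>k. 2 * (\<Sum>i\<in>UNIV. \<Sum>j\<in>UNIV. segment_integral (r k) (h i j) x z))"
proof -
  \<comment> \<open>The zero extension is bounded and Borel. It may jump at the sphere, but limits
    are taken only at points of the open ball, near which it agrees with the coordinate of
    \<phi>.\<close>
  define U where "U i y = indicator B y * \<phi> y $ i" for i y
  define \<Phi> where "\<Phi> k q = (\<chi> i. LINT y|lborel. U i y * r k (q - y))" for k q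
  define \<gamma> where "\<gamma> \<tau> = x + \<tau> *\<^sub>R (z - x)" for \<tau>
  \<comment> \<open>A density whose integral over {s<..t} bounds the displacement of the mollified
    curve. The sum over i comes from the l1 bound of the norm, the sum over j from the chain rule,
    and 2 bounds each component of z - x.\<close>
  define \<rho> where "\<rho> k \<tau> = 2 * (\<Sum>i\<in>UNIV. \<Sum>j\<in>UNIV. \<integral>\<^sup>+y. ennreal (\<bar>h i j y\<bar> * r k (\<gamma> \<tau> - y)) \<partial>lborel)" for k \<tau>
  have B: "open B" by (simp add: B_def)
  have Umeas [measurable]: "U i \<in> borel_measurable borel" for i
  proof -
    have "continuous_on B (\<lambda>y. \<phi> y $ i)" using cont by (intro continuous_intros)
    then show ?thesis
      using borel_measurable_continuous_on_indicator[of B "\<lambda>y. \<phi> y $ i"] B by (simp add: U_def[abs_def])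
  qed
  obtain M where "\<forall>v\<in>\<phi> ` B. norm v \<le> M"
    using bdd unfolding bounded_iff ..
  then have M: "norm (\<phi> y) \<le> M" if "y \<in> B" for y
    using that by blast
  have "M \<ge> 0" using M[OF x] norm_ge_zero[of "\<phi> x"] by linarith
  have Ubdd: "\<bar>U i y\<bar> \<le> M" for i y
    using M[of y] \<open>M \<ge> 0\<close> component_le_norm_cart[of "\<phi> y" i] by (auto simp: U_def indicator_def)
  have rcont: "continuous_on UNIV (r k)" for k
    using r(1) by (rule C_k_continuous)
  have [measurable]: "r k \<in> borel_measurable borel" for k
    using rcont by (rule borel_measurable_continuous_onI)
  have intU: "integrable lborel (\<lambda>y. U i y * r k (q - y))" for i k q
    using r(5) by (intro integrable_bounded_times_reflected[OF Umeas Ubdd rcont, of "\<delta> k"]) force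
  \<comment> \<open>The whole segment lies in the closed ball of radius m < 1, so kernels of radius
    less than 1 - m centred on it are supported in B.\<close>
  define m where "m = max (norm x) (norm z)"
  have "m < 1" using x z by (simp add: m_def B_def)
  have \<gamma>_norm: "norm (\<gamma> \<tau>) \<le> m" if "\<tau> \<in> {0..1}" for \<tau>
  proof -
    have "\<gamma> \<tau> \<in> closed_segment x z"
      using that by (auto simp: \<gamma>_def in_segment algebra_simps intro!: exI[of _ \<tau>])
    moreover have "closed_segment x z \<subseteq> cball 0 m"
      by (intro closed_segment_subset) (auto simp: m_def)
    ultimately show ?thesis by auto
  qed
  have \<gamma>B: "\<gamma> \<tau> \<in> B" if "\<tau> \<in> {0..1}" for \<tau>
    using \<gamma>_norm[OF that] \<open>m < 1\<close> by (simp add: B_def)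
  have vbound: "\<bar>(z - x) $ j\<bar> \<le> 2" for j
    using component_le_norm_cart[of "z - x" j] norm_triangle_ineq4[of z x] x z by (simp add: B_def)
  have [measurable]: "\<rho> k \<in> borel_measurable borel" for k
    unfolding \<rho>_def \<gamma>_def by measurable
  have increment: "ennreal (dist (\<Phi> k (\<gamma> s)) (\<Phi> k (\<gamma> t))) \<le> emeasure (density lborel (\<rho> k)) {s<..t}"
    if k: "\<delta> k < 1 - m" and st: "0 \<le> s" "s \<le> t" "t \<le> 1" for k s t
  proof -
    have weak': "(LINT y|lborel. U i y * partial_deriv j (r k) (x + \<tau> *\<^sub>R (z - x) - y)) =
        (LINT y|lborel. h i j y * r k (x + \<tau> *\<^sub>R (z - x) - y))" if "\<tau> \<in> {s..t}" for \<tau> i j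
    proof -
      have "cball (\<gamma> \<tau>) (\<delta> k) \<subseteq> B"
      proof
        fix y assume "y \<in> cball (\<gamma> \<tau>) (\<delta> k)"
        then have "norm (\<gamma> \<tau> - y) \<le> \<delta> k" by (simp add: dist_norm)
        then show "y \<in> B"
          using \<gamma>_norm[of \<tau>] that st k norm_triangle_ineq4[of "\<gamma> \<tau>" "\<gamma> \<tau> - y"] by (simp add: B_def)
      qed
      from test_function_reflected_mollifier[OF r(1) r(5) this]
      have "test_function B (\<lambda>y. r k (\<gamma> \<tau> - y))" .
      from weak[OF this, of i j] show ?thesis
        by (simp add: partial_deriv_reflected[OF r(1)] U_def \<gamma>_def)
    qed
    have "dist (\<Phi> k (\<gamma> s)) (\<Phi> k (\<gamma> t)) \<le> (\<Sum>i\<in>UNIV. \<bar>(\<Phi> k (\<gamma> t) - \<Phi> k (\<gamma> s)) $ i\<bar>)"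
      unfolding dist_norm norm_minus_commute[of "\<Phi> k (\<gamma> s)"] by (rule norm_le_l1_cart)
    then have "ennreal (dist (\<Phi> k (\<gamma> s)) (\<Phi> k (\<gamma> t))) \<le> (\<Sum>i\<in>UNIV. ennreal \<bar>(\<Phi> k (\<gamma> t) - \<Phi> k (\<gamma> s)) $ i\<bar>)"
      by (simp add: ennreal_leI)
    also have "\<dots> \<le> (\<Sum>i\<in>UNIV. \<integral>\<^sup>+\<tau>. indicator {s<..t} \<tau> *
         (\<Sum>j\<in>UNIV. ennreal \<bar>(z - x) $ j\<bar> * (\<integral>\<^sup>+y. ennreal (\<bar>h i j y\<bar> * r k (x + \<tau> *\<^sub>R (z - x) - y)) \<partial>lborel)) \<partial>lborel)"
    proof (rule sum_mono)
      fix i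
      show "ennreal \<bar>(\<Phi> k (\<gamma> t) - \<Phi> k (\<gamma> s)) $ i\<bar> \<le> (\<integral>\<^sup>+\<tau>. indicator {s<..t} \<tau> *
         (\<Sum>j\<in>UNIV. ennreal \<bar>(z - x) $ j\<bar> * (\<integral>\<^sup>+y. ennreal (\<bar>h i j y\<bar> * r k (x + \<tau> *\<^sub>R (z - x) - y)) \<partial>lborel)) \<partial>lborel)"
        using mollification_increment_le[OF Umeas[of i] Ubdd[of i] r(1) r(2) r(5) \<open>s \<le> t\<close> weak']
        by (simp add: \<Phi>_def \<gamma>_def)
    qed
    also have "\<dots> \<le> (\<Sum>i\<in>UNIV. \<integral>\<^sup>+\<tau>. indicator {s<..t} \<tau> *
         (\<Sum>j\<in>UNIV. 2 * (\<integral>\<^sup>+y. ennreal (\<bar>h i j y\<bar> * r k (x + \<tau> *\<^sub>R (z - x) - y)) \<partial>lborel)) \<partial>lborel)"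
      using vbound by (intro sum_mono nn_integral_mono mult_left_mono mult_right_mono)
        (auto simp: ennreal_le_iff simp flip: ennreal_numeral)
    also have "\<dots> = (\<integral>\<^sup>+\<tau>. (\<Sum>i\<in>UNIV. indicator {s<..t} \<tau> *
         (\<Sum>j\<in>UNIV. 2 * (\<integral>\<^sup>+y. ennreal (\<bar>h i j y\<bar> * r k (x + \<tau> *\<^sub>R (z - x) - y)) \<partial>lborel))) \<partial>lborel)"
      by (rule nn_integral_sum[symmetric]) measurable
    also have "\<dots> = (\<integral>\<^sup>+\<tau>. \<rho> k \<tau> * indicator {s<..t} \<tau> \<partial>lborel)"
      by (simp add: \<rho>_def \<gamma>_def sum_distrib_left mult_ac)
    also have "\<dots> = emeasure (density lborel (\<rho> k)) {s<..t}"
      by (simp add: emeasure_density)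
    finally show ?thesis .
  qed
  have lim: "(\<lambda>k. \<Phi> k (\<gamma> \<tau>)) \<longlonglongrightarrow> (\<phi> \<circ> linepath x z) \<tau>" if "\<tau> \<in> {0..1}" for \<tau>
  proof -
    have "(\<lambda>k. \<Phi> k (\<gamma> \<tau>)) \<longlonglongrightarrow> (\<chi> i. U i (\<gamma> \<tau>))"
      unfolding \<Phi>_def
    proof (intro tendsto_vec_lambda mollification_tendsto[OF r(2-5) \<delta> intU])
      fix i
      have "isCont (\<lambda>y. \<phi> y $ i) (\<gamma> \<tau>)"
        using cont B \<gamma>B[OF that] by (intro continuous_component) (simp add: continuous_on_eq_continuous_at)
      moreover have "\<forall>\<^sub>F y in nhds (\<gamma> \<tau>). U i y = \<phi> y $ i"
        using B \<gamma>B[OF that] by (auto simp: U_def eventually_nhds)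
      ultimately show "isCont (U i) (\<gamma> \<tau>)" by (simp add: isCont_cong)
    qed
    also have "(\<chi> i. U i (\<gamma> \<tau>)) = (\<phi> \<circ> linepath x z) \<tau>"
      using \<gamma>B[OF that] by (simp add: vec_eq_iff U_def \<gamma>_def linepath_def algebra_simps)
    finally show ?thesis .
  qed
  have "curve_length (\<phi> \<circ> linepath x z) \<le> liminf (\<lambda>k. emeasure (density lborel (\<rho> k)) {0<..1})"
  proof (rule curve_length_le_liminf[OF lim])
    have "\<forall>\<^sub>F k in sequentially. \<delta> k < 1 - m"
      using \<delta> \<open>m < 1\<close> by (intro order_tendstoD) auto
    then show "\<forall>\<^sub>F k in sequentially. \<forall>s t. 0 \<le> s \<longrightarrow> s \<le> t \<longrightarrow> t \<le> 1 \<longrightarrow>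
       ennreal (dist (\<Phi> k (\<gamma> s)) (\<Phi> k (\<gamma> t))) \<le> emeasure (density lborel (\<rho> k)) {s<..t}"
      by eventually_elim (use increment in blast)
  qed auto
  also have "(\<lambda>k. emeasure (density lborel (\<rho> k)) {0<..1}) =
      (\<lambda>k. 2 * (\<Sum>i\<in>UNIV. \<Sum>j\<in>UNIV. segment_integral (r k) (h i j) x z))"
  proof
    fix k
    define f where "f i j \<tau> = indicator {0<..1} \<tau> *
        (\<integral>\<^sup>+y. ennreal (\<bar>h i j y\<bar> * r k (\<gamma> \<tau> - y)) \<partial>lborel)" for i j \<tau>
    have [measurable]: "f i j \<in> borel_measurable borel" for i j
      unfolding f_def \<gamma>_def by measurable
    have "emeasure (density lborel (\<rho> k)) {0<..1} = (\<integral>\<^sup>+\<tau>. \<rho> k \<tau> * indicator {0<..1} \<tau> \<partial>lborel)"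
      by (simp add: emeasure_density)
    also have "\<dots> = (\<integral>\<^sup>+\<tau>. 2 * (\<Sum>i\<in>UNIV. \<Sum>j\<in>UNIV. f i j \<tau>) \<partial>lborel)"
      by (simp only: \<rho>_def f_def sum_distrib_left sum_distrib_right mult_ac)
    also have "\<dots> = 2 * (\<Sum>i\<in>UNIV. \<Sum>j\<in>UNIV. \<integral>\<^sup>+\<tau>. f i j \<tau> \<partial>lborel)"
      by (simp add: nn_integral_cmult nn_integral_sum)
    also have "\<dots> = 2 * (\<Sum>i\<in>UNIV. \<Sum>j\<in>UNIV. segment_integral (r k) (h i j) x z)"
      by (simp only: f_def segment_integral_def \<gamma>_def)
    finally show "emeasure (density lborel (\<rho> k)) {0<..1} = \<dots>" .
  qed
  finally show ?thesis .
qed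

section \<open>Geodesic diameter of the image\<close>

lemma geodesic_dist_image_le:
  assumes "continuous_on B \<phi>" "convex B" "x \<in> B" "y \<in> B" "z \<in> B"
  shows "geodesic_dist (\<phi> ` B) (\<phi> x) (\<phi> y) \<le>
    curve_length (\<phi> \<circ> linepath x z) + curve_length (\<phi> \<circ> linepath y z)"
proof -
  have p: "path (\<phi> \<circ> linepath a z) \<and> path_image (\<phi> \<circ> linepath a z) \<subseteq> \<phi> ` B" if "a \<in> B" for a
  proof -
    have sub: "path_image (linepath a z) \<subseteq> B"
      using that assms by (simp add: closed_segment_subset)
    then have "path (\<phi> \<circ> linepath a z)"
      using assms(1) by (intro path_continuous_image) (auto intro: continuous_on_subset)
    then show ?thesis using sub by (simp add: path_image_compose image_mono del: path_image_linepath)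
  qed
  \<comment> \<open>Both segments are directed towards z, so that one estimate, with z as the
    variable of averaging, serves x and y alike; hence the second image is traversed
    backwards.\<close>
  let ?\<gamma> = "(\<phi> \<circ> linepath x z) +++ reversepath (\<phi> \<circ> linepath y z)"
  have join: "pathfinish (\<phi> \<circ> linepath x z) = pathstart (reversepath (\<phi> \<circ> linepath y z))"
    by (simp add: pathfinish_compose)
  have "geodesic_dist (\<phi> ` B) (\<phi> x) (\<phi> y) \<le> curve_length ?\<gamma>"
  proof (rule geodesic_dist_le)
    show "path ?\<gamma>" using p assms join by simp
    show "path_image ?\<gamma> \<subseteq> \<phi> ` B" using p assms by (intro subset_path_image_join) auto
  qed (simp_all add: pathstart_compose)
  also have "\<dots> \<le> curve_length (\<phi> \<circ> linepath x z) + curve_length (reversepath (\<phi> \<circ> linepath y z))"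
    by (rule curve_length_joinpaths_le[OF join])
  also have "\<dots> \<le> curve_length (\<phi> \<circ> linepath x z) + curve_length (\<phi> \<circ> linepath y z)"
    by (intro add_left_mono curve_length_reversepath_le)
  finally show ?thesis .
qed

lemma geodesic_diameter_image_finite:
  fixes \<phi> :: "real^'n \<Rightarrow> real^'n"
  assumes cont: "continuous_on (ball 0 1) \<phi>" and bdd: "bounded (\<phi> ` ball 0 1)"
    and L1: "\<phi> \<in> L1_space p (ball 0 1)" and p: "p > CARD('n)"
  shows "geodesic_diameter (\<phi> ` ball 0 1) < \<infinity>"
proof -
  let ?B = "ball (0::real^'n) 1"
  have "p \<ge> 0" using p by linarith
  define repr where "repr i H \<longleftrightarrow> (\<forall>j. H j \<in> borel_measurable borel) \<and>
      (\<forall>j. (\<integral>\<^sup>+x. ennreal (\<bar>H j x\<bar> powr p) \<partial>lborel) < \<infinity>) \<and>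
      (\<forall>\<eta> j. test_function ?B \<eta> \<longrightarrow>
       (LINT x|lborel. indicator ?B x * \<phi> x $ i * partial_deriv j \<eta> x) = - (LINT x|lborel. H j x * \<eta> x))"
    for i and H :: "'n \<Rightarrow> real^'n \<Rightarrow> real"
  have "\<exists>H. repr i H" for i
  proof -
    from L1 obtain g where g: "has_weak_gradient ?B (\<lambda>x. \<phi> x $ i) g" "g \<in> L_space p ?B"
      unfolding L1_space_def by blast
    have "continuous_on ?B (\<lambda>x. \<phi> x $ i)" using cont by (intro continuous_intros)
    then show ?thesis
    proof (rule weak_gradient_borel_representative[OF open_ball _ g \<open>p \<ge> 0\<close>])
      fix H :: "'n \<Rightarrow> real^'n \<Rightarrow> real"
      assume "\<And>j. H j \<in> borel_measurable borel"
        "\<And>j. (\<integral>\<^sup>+x. ennreal (\<bar>H j x\<bar> powr p) \<partial>lborel) < \<infinity>"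
        "\<And>\<eta> j. test_function ?B \<eta> \<Longrightarrow>
         (LINT x|lborel. indicator ?B x * \<phi> x $ i * partial_deriv j \<eta> x) = - (LINT x|lborel. H j x * \<eta> x)"
      then have "repr i H" unfolding repr_def by simp
      then show ?thesis by blast
    qed
  qed
  then obtain h where "\<And>i. repr i (h i)" using choice[of repr] by auto
  then have h [measurable]: "\<And>i j. h i j \<in> borel_measurable borel"
    and hp: "\<And>i j. (\<integral>\<^sup>+x. ennreal (\<bar>h i j x\<bar> powr p) \<partial>lborel) < \<infinity>"
    and weak: "\<And>i j \<eta>. test_function ?B \<eta> \<Longrightarrow>
       (LINT x|lborel. indicator ?B x * \<phi> x $ i * partial_deriv j \<eta> x) = - (LINT x|lborel. h i j x * \<eta> x)"
    unfolding repr_def by simp_all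
  define average_bound where "average_bound i j C \<longleftrightarrow> C < \<infinity> \<and>
      (\<forall>q x. (\<integral>\<^sup>+\<tau>. \<integral>\<^sup>+z. indicator {0<..1} \<tau> * indicator ?B z *
        ennreal \<bar>h i j (q + \<tau> *\<^sub>R (z - x))\<bar> \<partial>lborel \<partial>lborel) \<le> C)" for i j C
  have "\<exists>C. average_bound i j C" for i j
  proof -
    have "real DIM(real^'n) < p" using p by simp
    then show ?thesis
    proof (rule segment_average_bounded[OF h _ hp])
      fix C
      assume "C < \<infinity>" "\<And>q x. (\<integral>\<^sup>+\<tau>. \<integral>\<^sup>+z. indicator {0<..1} \<tau> * indicator ?B z *
        ennreal \<bar>h i j (q + \<tau> *\<^sub>R (z - x))\<bar> \<partial>lborel \<partial>lborel) \<le> C"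
      then have "average_bound i j C" unfolding average_bound_def by simp
      then show ?thesis by blast
    qed
  qed
  then obtain C where "\<And>i j. average_bound i j (C i j)" by metis
  then have C: "\<And>i j. C i j < \<infinity>"
    "\<And>i j q x. (\<integral>\<^sup>+\<tau>. \<integral>\<^sup>+z. indicator {0<..1} \<tau> * indicator ?B z *
        ennreal \<bar>h i j (q + \<tau> *\<^sub>R (z - x))\<bar> \<partial>lborel \<partial>lborel) \<le> C i j"
    unfolding average_bound_def by simp_all
  define \<delta> where "\<delta> k = inverse (real (Suc k))" for k
  have \<delta>: "\<delta> \<longlonglongrightarrow> 0" unfolding \<delta>_def by (rule LIMSEQ_inverse_real_of_nat)
  have "\<exists>r::real^'n \<Rightarrow> real. (\<forall>m. C_k m r) \<and> (\<forall>x. r x \<ge> 0) \<and> (\<forall>x. r x \<noteq> 0 \<longrightarrow> norm x \<le> \<delta> k) \<and>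
      integrable lborel r \<and> (LINT x|lborel. r x) = 1" for k
  proof -
    have "\<delta> k > 0" by (simp add: \<delta>_def)
    show ?thesis by (rule mollifier_exists[OF \<open>\<delta> k > 0\<close>]) blast
  qed
  then obtain r :: "nat \<Rightarrow> real^'n \<Rightarrow> real" where r: "\<And>m k. C_k m (r k)" "\<And>k x. r k x \<ge> 0"
      "\<And>k. integrable lborel (r k)" "\<And>k. (LINT x|lborel. r k x) = 1"
      "\<And>k x. r k x \<noteq> 0 \<Longrightarrow> norm x \<le> \<delta> k"
    by metis
  have [measurable]: "r k \<in> borel_measurable borel" for k
    using C_k_continuous[OF r(1)] by (rule borel_measurable_continuous_onI)
  define S where "S k x z = 2 * (\<Sum>i\<in>UNIV. \<Sum>j\<in>UNIV. segment_integral (r k) (h i j) x z)" for k x z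
  \<comment> \<open>A Borel function of z that dominates the length of the image of the segment from
    x to z; it replaces the length in the averaging.\<close>
  define L where "L x z = liminf (\<lambda>k. S k x z)" for x z
  have Smeas [measurable]: "S k x \<in> borel_measurable borel" for k x
    unfolding S_def[abs_def] by measurable
  have Lmeas [measurable]: "L x \<in> borel_measurable borel" for x
    unfolding L_def[abs_def] by measurable
  have bmeas [measurable]: "(indicator ?B :: _ \<Rightarrow> ennreal) \<in> borel_measurable borel"
    by (rule borel_measurable_indicator) simp
  \<comment> \<open>Bounds the integral of \<open>S k x\<close> over the ball for all k and all x at
    once.\<close>
  define K where "K = 2 * (\<Sum>i\<in>UNIV. \<Sum>j\<in>UNIV. C i j)"
  have "K < \<infinity>" using C(1) by (simp add: K_def ennreal_mult_less_top)
  then obtain K' where K': "K = ennreal K'" "K' \<ge> 0" by (cases K) auto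
  have S_le: "(\<integral>\<^sup>+z. indicator ?B z * S k x z \<partial>lborel) \<le> K" for k x
  proof -
    define f where "f i j z = indicator ?B z * segment_integral (r k) (h i j) x z" for i j z
    have [measurable]: "f i j \<in> borel_measurable borel" for i j
      unfolding f_def by (intro borel_measurable_times_ennreal bmeas) measurable
    have "(\<integral>\<^sup>+z. indicator ?B z * S k x z \<partial>lborel) = (\<integral>\<^sup>+z. 2 * (\<Sum>i\<in>UNIV. \<Sum>j\<in>UNIV. f i j z) \<partial>lborel)"
      by (simp only: S_def f_def sum_distrib_left mult_ac)
    also have "\<dots> = 2 * (\<Sum>i\<in>UNIV. \<Sum>j\<in>UNIV. \<integral>\<^sup>+z. f i j z \<partial>lborel)"
      by (simp add: nn_integral_cmult nn_integral_sum)
    also have "\<dots> \<le> K"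
      unfolding K_def f_def
      by (intro mult_left_mono sum_mono segment_integral_average_le r C(2)) auto
    finally show ?thesis .
  qed
  have L_le: "(\<integral>\<^sup>+z. indicator ?B z * L x z \<partial>lborel) \<le> K" for x
  proof -
    have "(\<integral>\<^sup>+z. indicator ?B z * L x z \<partial>lborel) = (\<integral>\<^sup>+z. liminf (\<lambda>k. indicator ?B z * S k x z) \<partial>lborel)"
      by (intro nn_integral_cong) (auto simp: L_def indicator_def Liminf_const)
    also have "\<dots> \<le> liminf (\<lambda>k. \<integral>\<^sup>+z. indicator ?B z * S k x z \<partial>lborel)"
      by (intro nn_integral_liminf) measurable
    also have "\<dots> \<le> liminf (\<lambda>k::nat. K)"
      by (intro Liminf_mono always_eventually allI S_le)
    finally show ?thesis by (simp add: Liminf_const)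
  qed
  define V where "V = measure lborel ?B"
  have V: "V > 0" "emeasure lborel ?B = ennreal V"
    using content_ball_pos[of 1 "0::real^'n"] emeasure_lborel_ball_finite[of "0::real^'n" 1]
    by (auto simp: V_def emeasure_eq_ennreal_measure)
  \<comment> \<open>If L x + L y were at least c on the whole ball, its integral would be at least c
    V = 2 K' + 1, whereas it is at most 2 K'. The summand 1 makes the contradiction strict even when
    K' = 0.\<close>
  define c where "c = (2 * K' + 1) / V"
  have "c \<ge> 0" using K' V by (simp add: c_def)
  have good: "\<exists>z\<in>?B. L x z + L y z \<le> ennreal c" for x y
  proof (rule ccontr)
    assume "\<not> ?thesis"
    then have *: "ennreal c \<le> L x z + L y z" if "z \<in> ?B" for z
      using that by (meson linear)
    have "ennreal (2 * K' + 1) = ennreal c * emeasure lborel ?B"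
      using V \<open>c \<ge> 0\<close> by (simp add: c_def flip: ennreal_mult)
    also have "\<dots> = (\<integral>\<^sup>+z. ennreal c * indicator ?B z \<partial>lborel)"
      by (simp add: nn_integral_cmult)
    also have "\<dots> \<le> (\<integral>\<^sup>+z. indicator ?B z * L x z + indicator ?B z * L y z \<partial>lborel)"
      using * by (intro nn_integral_mono) (auto simp: indicator_def)
    also have "\<dots> = (\<integral>\<^sup>+z. indicator ?B z * L x z \<partial>lborel) + (\<integral>\<^sup>+z. indicator ?B z * L y z \<partial>lborel)"
      by (intro nn_integral_add) measurable
    also have "\<dots> \<le> K + K" by (intro add_mono L_le)
    also have "\<dots> = ennreal (2 * K')" unfolding K'(1) using K'(2) by (simp flip: ennreal_plus)
    finally show False using K'(2) by (simp add: ennreal_le_iff)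
  qed
  have "geodesic_dist (\<phi> ` ?B) (\<phi> x) (\<phi> y) \<le> ennreal c" if xy: "x \<in> ?B" "y \<in> ?B" for x y
  proof -
    obtain z where z: "z \<in> ?B" "L x z + L y z \<le> ennreal c" using good[of x y] by (elim bexE)
    have "curve_length (\<phi> \<circ> linepath a z) \<le> L a z" if "a \<in> ?B" for a
      unfolding L_def S_def
      by (rule image_segment_length_le[where \<phi> = \<phi> and x = a and z = z and h = h and r = r and \<delta> = \<delta>, OF cont bdd h weak r \<delta> that z(1)])
    then have "curve_length (\<phi> \<circ> linepath x z) + curve_length (\<phi> \<circ> linepath y z) \<le> L x z + L y z"
      using xy by (intro add_mono) auto
    with geodesic_dist_image_le[OF cont convex_ball xy z(1)] z(2) show ?thesis
      by (auto intro: order_trans)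
  qed
  then have "geodesic_diameter (\<phi> ` ?B) \<le> ennreal c"
    unfolding geodesic_diameter_def by (auto intro!: SUP_least)
  then show ?thesis by (simp add: le_less_trans)
qed

theorem mainTheorem4:
  fixes D :: "(real^'n) set" and \<epsilon> :: real
  assumes "CARD('n) \<ge> 2"
    and "is_domain D"
    and "bounded D"
    and "geodesic_diameter D = \<infinity>"
    and "\<epsilon> > 0"
  shows "\<not> (\<exists>\<phi>. quasiconformal (ball 0 1) D \<phi> \<and>
              \<phi> \<in> L1_space (real CARD('n) + \<epsilon>) (ball 0 1))"
proof
  assume "\<exists>\<phi>. quasiconformal (ball 0 1) D \<phi> \<and> \<phi> \<in> L1_space (real CARD('n) + \<epsilon>) (ball 0 1)"
  then obtain \<phi> \<psi> where "homeomorphism (ball 0 1) D \<phi> \<psi>"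
    and L1: "\<phi> \<in> L1_space (real CARD('n) + \<epsilon>) (ball 0 1)"
    unfolding quasiconformal_def by blast
  then have "continuous_on (ball 0 1) \<phi>" and D: "\<phi> ` ball 0 1 = D"
    by (auto simp: homeomorphism_def)
  \<comment> \<open>The bounded image is D itself, and \<epsilon> > 0 puts the exponent above
    n.\<close>
  then have "geodesic_diameter D < \<infinity>"
    using geodesic_diameter_image_finite[OF _ _ L1] assms(3,5) by auto
  with assms(4) show False by simp
qed

end
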